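(* Let $n\ge 4$, and let $c$ be a multiple of $4$ such that $0\le c\le 2^n-4n$. If $n\ge \frac{c}{4}+4$, then $T_{n+1}^c$ is equal to the space of elements of $A_{n+1}$ of the form $\{a,0\}$ or $\{0,a\}$ such that $a$ belongs to $T_n^c$.
   Context: The Cayley-Dickson algebras $A_n$ are real algebras with involution defined inductively: $A_0=\mathbb{R}$ with trivial conjugation, and $A_n=A_{n-1}\times A_{n-1}$ additively, with $(a,b)^*=(a^*,-b)$ and $(a,b)(c,d)=(ac-d^*b,\;da+bc^* )$. For $n\ge 1$ put $i_n=(0,1)\in A_n$, and let $\mathbb{C}_n$ be the $\mathbb{R}$-linear span of $1=(1,0)$ and $i_n$. The real inner product is $\langle a,b\rangle_{\mathbb{R}}=\mathrm{Re}(ab^* )$, where $\mathrm{Re}(x)=\frac12(x+x^* )$, with norm $|a|=\sqrt{aa^*}$; $\mathbb{C}_n^\perp$ is the orthogonal complement of $\mathbb{C}_n$ in $A_n$. For $a,b\in\mathbb{C}_n^\perp$, $\{a,b\}$ denotes the element $\frac{1}{\sqrt2}\big(a+b,\;i_n(-a+b)\big)$ of $A_{n+1}$. For $x\in A_m$, $\mathrm{Ann}(x)=\{y\in A_m: xy=0\}$; dimensions are over $\mathbb{R}$. For $m\ge 4$ and $c$ a multiple of $4$ with $0\le c\le 2^m-4m$, $T_m^c$ is the space of elements of length (norm) one in $A_m$ whose annihilators have dimension at least $(2^m-4m+4)-c$. (Zero-divisors of $A_m$ lie in $\mathbb{C}_m^\perp$, so $T_m^c\subset\mathbb{C}_m^\perp$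 and the notation $\{a,0\},\{0,a\}$ makes sense for $a\in T_n^c$.) *)

theory Defs
  imports "HOL-Analysis.Analysis" "HOL-Analysis.Finite_Function_Topology"
begin

text \<open>
  The level \<open>n\<close> varies inside the statements, so \<open>A_n\<close> is a carrier set rather than a type: it
  consists of the real coefficient sequences supported on \<open>{0..<2^n}\<close>, and \<open>(a, b)\<close> with
  \<open>a, b\<close> in \<open>A_n\<close> is the concatenation of the two coefficient blocks, an element of \<open>A_(n+1)\<close>.
  The type \<open>nat \<Rightarrow>\<^sub>0 real\<close> serves only as an ambient real vector space, which makes the
  library's \<^const>\<open>dim\<close> available; its convolution product \<open>*\<close> and its norm (which is the
  sum of absolute values) are never used.
\<close>

type_synonym cd = "nat \<Rightarrow>\<^sub>0 real"

definition cd_carrier :: "nat \<Rightarrow> cd set" where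
  "cd_carrier n = {x. Poly_Mapping.keys x \<subseteq> {..<2 ^ n}}"

lift_definition cd_pair :: "nat \<Rightarrow> cd \<Rightarrow> cd \<Rightarrow> cd" is
  "\<lambda>n a b k. if k < 2 ^ n then a k else if k < 2 ^ Suc n then b (k - 2 ^ n) else 0"
  subgoal for n a b
    by (rule finite_subset[of _ "{..<2 ^ Suc n}"]) (auto split: if_splits)
  done

lift_definition cd_fst :: "nat \<Rightarrow> cd \<Rightarrow> cd" is
  "\<lambda>n x k. if k < 2 ^ n then x k else 0"
  subgoal for n x
    by (rule finite_subset[of _ "{..<2 ^ n}"]) (auto split: if_splits)
  done

lift_definition cd_snd :: "nat \<Rightarrow> cd \<Rightarrow> cd" is
  "\<lambda>n x k. if k < 2 ^ n then x (2 ^ n + k) else 0"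
  subgoal for n x
    by (rule finite_subset[of _ "{..<2 ^ n}"]) (auto split: if_splits)
  done

text \<open>The real number \<open>r\<close>, as the element \<open>r \<cdot> 1\<close> of every \<open>A_n\<close>.\<close>

abbreviation cd_real :: "real \<Rightarrow> cd" where
  "cd_real r \<equiv> Poly_Mapping.single 0 r"

primrec cd_conj :: "nat \<Rightarrow> cd \<Rightarrow> cd" where
  "cd_conj 0 x = x"
| "cd_conj (Suc n) x = cd_pair n (cd_conj n (cd_fst n x)) (- cd_snd n x)"

primrec cd_mult :: "nat \<Rightarrow> cd \<Rightarrow> cd \<Rightarrow> cd" where
  "cd_mult 0 x y = cd_real (Poly_Mapping.lookup x 0 * Poly_Mapping.lookup y 0)"
| "cd_mult (Suc n) x y =
    (let a = cd_fst n x; b = cd_snd n x; c = cd_fst n y; d = cd_snd n y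
     in cd_pair n (cd_mult n a c - cd_mult n (cd_conj n d) b)
                  (cd_mult n d a + cd_mult n b (cd_conj n c)))"

text \<open>\<open>i_n = (0, 1)\<close>; the value at \<open>n = 0\<close>, where \<open>i_n\<close> is undefined, is a dummy.\<close>

primrec cd_i :: "nat \<Rightarrow> cd" where
  "cd_i 0 = 0"
| "cd_i (Suc n) = cd_pair n 0 (cd_real 1)"

text \<open>\<open>a a\<^sup>*\<close> is a real multiple of 1 (see \<open>cd_mult_conj_real\<close> below), read off as its
  coefficient at 0.\<close>

definition cd_norm :: "nat \<Rightarrow> cd \<Rightarrow> real" where
  "cd_norm n a = sqrt (Poly_Mapping.lookup (cd_mult n a (cd_conj n a)) 0)"

definition cd_Ann :: "nat \<Rightarrow> cd \<Rightarrow> cd set" where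
  "cd_Ann n x = {y \<in> cd_carrier n. cd_mult n x y = 0}"

text \<open>The notation \<open>{a, b}\<close>, an element of \<open>A_(n+1)\<close>. It is meant for \<open>a, b\<close> in the orthogonal
  complement of \<open>\<complex>_n\<close>; the formula is total here.\<close>

definition cd_brace :: "nat \<Rightarrow> cd \<Rightarrow> cd \<Rightarrow> cd" where
  "cd_brace n a b = (1 / sqrt 2) *\<^sub>R cd_pair n (a + b) (cd_mult n (cd_i n) (- a + b))"

text \<open>\<open>T_m^c\<close>; the bound is compared over the integers to avoid truncated subtraction.\<close>

definition cd_T :: "nat \<Rightarrow> nat \<Rightarrow> cd set" where
  "cd_T m c = {x \<in> cd_carrier m. cd_norm m x = 1 \<and>
     int (dim (cd_Ann m x)) \<ge> (2 ^ m - 4 * int m + 4) - int c}"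


lemma cd_carrier_iff: "x \<in> cd_carrier n \<longleftrightarrow> (\<forall>k\<ge>2 ^ n. Poly_Mapping.lookup x k = 0)"
  by (auto simp: cd_carrier_def in_keys_iff subset_iff not_le[symmetric])

lemma lookup_scaleR [simp]:
  "Poly_Mapping.lookup (r *\<^sub>R (x :: cd)) k = r * Poly_Mapping.lookup x k"
  by (simp add: scaleR_poly_mapping_def)

lemma cd_carrier_subspace: "subspace (cd_carrier n)"
  by (auto simp: subspace_def cd_carrier_iff lookup_add)

lemma cd_carrier_0: "x \<in> cd_carrier 0 \<longleftrightarrow> (\<exists>r. x = cd_real r)"
  by (auto simp: cd_carrier_iff lookup_single when_def
      intro!: exI[of _ "Poly_Mapping.lookup x 0"] poly_mapping_eqI)

lemma cd_pair_carrier [simp]: "cd_pair n a b \<in> cd_carrier (Suc n)"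
  by (auto simp: cd_carrier_iff cd_pair.rep_eq)

lemma cd_fst_carrier [simp]: "cd_fst n x \<in> cd_carrier n"
  and cd_snd_carrier [simp]: "cd_snd n x \<in> cd_carrier n"
  by (auto simp: cd_carrier_iff cd_fst.rep_eq cd_snd.rep_eq)

lemma cd_fst_pair: "a \<in> cd_carrier n \<Longrightarrow> cd_fst n (cd_pair n a b) = a"
  and cd_snd_pair: "b \<in> cd_carrier n \<Longrightarrow> cd_snd n (cd_pair n a b) = b"
  by (auto intro!: poly_mapping_eqI simp: cd_carrier_iff cd_fst.rep_eq cd_snd.rep_eq cd_pair.rep_eq)

lemma cd_pair_fst_snd: "x \<in> cd_carrier (Suc n) \<Longrightarrow> cd_pair n (cd_fst n x) (cd_snd n x) = x"
  by (auto intro!: poly_mapping_eqI simp: cd_carrier_iff cd_fst.rep_eq cd_snd.rep_eq cd_pair.rep_eq)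

lemma cd_pair_real: "cd_pair n (cd_real r) 0 = cd_real r"
  by (auto intro!: poly_mapping_eqI simp: cd_pair.rep_eq lookup_single when_def)

lemma cd_uminus_carrier [simp]: "- x \<in> cd_carrier n \<longleftrightarrow> x \<in> cd_carrier n"
  by (simp add: cd_carrier_iff)

lemma cd_conj_carrier: "x \<in> cd_carrier n \<Longrightarrow> cd_conj n x \<in> cd_carrier n"
  by (cases n) auto

lemma cd_mult_carrier: "cd_mult n x y \<in> cd_carrier n"
  by (cases n) (auto simp: cd_carrier_0 Let_def)

lemma cd_conj_conj: "x \<in> cd_carrier n \<Longrightarrow> cd_conj n (cd_conj n x) = x"
  by (induction n arbitrary: x)
     (simp_all add: cd_fst_pair cd_snd_pair cd_conj_carrier cd_pair_fst_snd)

lemma cd_mult_minus_right: "cd_mult n x (- y) = - cd_mult n x y"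
  and cd_mult_minus_left: "cd_mult n (- x) y = - cd_mult n x y"
  and cd_conj_minus: "cd_conj n (- x) = - cd_conj n x"
proof -
  have p: "cd_pair n (- a) (- b) = - cd_pair n a b" for n a b
    by (auto intro!: poly_mapping_eqI simp: cd_pair.rep_eq)
  have f: "cd_fst n (- a) = - cd_fst n a" "cd_snd n (- a) = - cd_snd n a" for n a
    by (auto intro!: poly_mapping_eqI simp: cd_fst.rep_eq cd_snd.rep_eq)
  have c: "cd_conj n (- x) = - cd_conj n x" for n x
    by (induction n arbitrary: x) (simp_all add: f p[symmetric])
  have q: "- a - b = - b - a" for a b :: cd
    by (metis add.commute diff_conv_add_uminus)
  have "cd_mult n x (- y) = - cd_mult n x y \<and> cd_mult n (- x) y = - cd_mult n x y"
    by (induction n arbitrary: x y)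
       (simp_all add: Let_def f c p[symmetric] single_uminus q)
  then show "cd_mult n x (- y) = - cd_mult n x y" "cd_mult n (- x) y = - cd_mult n x y"
    by auto
  show "cd_conj n (- x) = - cd_conj n x" by (rule c)
qed

lemma cd_mult_conj_real:
  assumes "x \<in> cd_carrier n"
  obtains r where "r \<ge> 0" "cd_mult n x (cd_conj n x) = cd_real r"
proof -
  have "\<exists>r\<ge>0. cd_mult n x (cd_conj n x) = cd_real r"
    using assms
  proof (induction n arbitrary: x)
    case 0
    then show ?case by (auto intro!: exI[of _ "Poly_Mapping.lookup x 0 * Poly_Mapping.lookup x 0"])
  next
    case (Suc n)
    define a b where "a = cd_fst n x" and "b = cd_snd n x"
    have ab: "a \<in> cd_carrier n" "b \<in> cd_carrier n" by (auto simp: a_def b_def)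
    obtain r where r: "r \<ge> 0" "cd_mult n a (cd_conj n a) = cd_real r"
      using Suc.IH[OF ab(1)] by auto
    obtain s where s: "s \<ge> 0" "cd_mult n (cd_conj n b) b = cd_real s"
      using Suc.IH[OF cd_conj_carrier[OF ab(2)]] cd_conj_conj[OF ab(2)] by auto
    have "cd_mult (Suc n) x (cd_conj (Suc n) x) = cd_pair n (cd_real r + cd_real s) 0"
      using r s ab
      by (simp add: Let_def a_def[symmetric] b_def[symmetric] cd_fst_pair cd_snd_pair
          cd_conj_carrier cd_conj_minus cd_mult_minus_left cd_conj_conj)
    also have "\<dots> = cd_real (r + s)"
      by (simp add: single_add[symmetric] cd_pair_real)
    finally show ?case using r s by (intro exI[of _ "r + s"]) auto
  qed
  then show thesis using that by auto
qed

end

(*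
  Write A_n = C_n + V with V the orthogonal complement of C_n. Then V is a complex vector space, and
  the product of x, y in V is H(x,y) + x o y with H a negative definite Hermitian form and "o"
  conjugate-bilinear and antisymmetric. Zero divisors of A_(n+1) have the form P(w,a,b), which is
  sqrt 2 {a,b} plus (Im w i_n, Re w i_n) with w complex, and in these coordinates P(w,a,b) P(v,x,y) = 0 becomes
    2 a o x + w y - v b = 0,         2 b o y - cnj w x + cnj v a = 0,
    2 cnj H(a,x) + 2 H(b,y) = w cnj v,      H(a,y) = H(x,b).
  If w is nonzero, the annihilator has dimension at most 2^n - 4. If w = 0, its dimension is
  dim Ann a + 2^n - 4 when only a is nonzero, and at most dim Ann a + dim Ann b + 4 in general.
  By induction dim Ann x <= 2^n - 4n + 4 for all nonzero x in A_n, starting from the octonions, and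
  under the hypothesis on c these bounds leave only {a,0} and {0,a}.
*)
theory Submission
  imports Defs
begin

subsection \<open>Rank and nullity\<close>

text \<open>Call 2^n - 4n + 4 - dim Ann x the defect of x in A_n; then T_n^c consists of the unit
  vectors of defect at most c. The number 2^n - 4n + 4 is zero at n = 3 and grows by exactly 2^n - 4
  from A_n to A_(n+1). That is also the gain from a nonzero a to {a,0}: x ranges over Ann a, and y
  over the vectors of V with H(a,y) = 0, a space of codimension 2 + 2 in A_n. Hence a and {a,0} have
  equal defect, while a, b both nonzero give {a,b} defect at least 4n - 12, and w nonzero forces at
  least 2^n - 4n + 4. The bounds on c keep it below both. The obstacle is w nonzero, where the
  equations do not decouple. They are not solved there: for b nonzero, pairing them with a and b
  shows that only the zero solution has x in the complex line of b, so the annihilator embeds into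
  the complement of b in V. Nonassociativity is met by moving i through products of vectors of V
  with (i x) y = (x y) i and x (i y) = - i (x y).\<close>

lemma dim_zero_set [simp]: "dim {0::'a::real_vector} = 0"
  using dim_span[of "{}::'a set"] dim_eq_card_independent[OF independent_empty] by simp

text \<open>The ambient type is infinite-dimensional, and \<open>dim\<close> is 0 on sets without a
  finite basis, so even monotonicity of \<open>dim\<close> needs finiteness. The finite spanning set
  \<open>B\<close> carries it through this section.\<close>

lemma finite_basis_exists:
  fixes S :: "'a::real_vector set"
  assumes "finite B" "S \<subseteq> span B"
  obtains C where "C \<subseteq> S" "independent C" "S \<subseteq> span C" "finite C" "card C = dim S"
proof -
  obtain C where C: "C \<subseteq> S" "independent C" "S \<subseteq> span C" "card C = dim S"
    by (rule basis_exists)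
  moreover have "finite C"
    using independent_span_bound[OF assms(1) C(2)] C(1) assms(2) by auto
  ultimately show thesis using that by blast
qed

lemma dim_mono_finite:
  fixes S T :: "'a::real_vector set"
  assumes "finite B" "T \<subseteq> span B" "S \<subseteq> T"
  shows "dim S \<le> dim T"
proof -
  obtain C where "C \<subseteq> T" "independent C" "T \<subseteq> span C" "finite C" "card C = dim T"
    using finite_basis_exists[OF assms(1,2)] .
  then show ?thesis using dim_le_card[of S C] assms(3) by auto
qed

lemma rank_nullity:
  fixes f :: "'a::real_vector \<Rightarrow> 'b::real_vector"
  assumes B: "finite B" "S \<subseteq> span B" and S: "subspace S" and f: "linear f"
  shows "dim S = dim {x \<in> S. f x = 0} + dim (f ` S)"
proof -
  define K where "K = {x \<in> S. f x = 0}"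
  have K: "subspace K"
    using S f by (auto simp: K_def subspace_def linear_add linear_scale linear_0)
  obtain C where C: "C \<subseteq> K" "independent C" "K \<subseteq> span C" "finite C" "card C = dim K"
    using finite_basis_exists[OF B(1), of K] B(2) by (auto simp: K_def)
  obtain D where D: "C \<subseteq> D" "D \<subseteq> S" "independent D" "S \<subseteq> span D"
    using maximal_independent_subset_extend[of C S] C by (auto simp: K_def)
  have finD: "finite D"
    using independent_span_bound[OF B(1) D(3)] D(2) B(2) by auto
  have dimS: "dim S = card D"
    using basis_card_eq_dim[OF D(2,4,3)] by simp
  have inj: "inj_on f (span (D - C))"
  proof (subst linear_inj_on_iff_eq_0[OF f subspace_span], intro ballI impI)
    fix x assume x: "x \<in> span (D - C)" "f x = 0"
    have "span (D - C) \<subseteq> S"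
      using D(2) S by (intro span_minimal) auto
    with x have "x \<in> span C" using C(3) by (auto simp: K_def)
    have "representation (D - C) x = representation D x"
      using x D(3) by (intro representation_extend[symmetric]) auto
    moreover have "representation C x = representation D x"
      using \<open>x \<in> span C\<close> D by (intro representation_extend[symmetric]) auto
    ultimately have "representation (D - C) x = representation C x" by simp
    \<comment> \<open>Both representations of \<open>x\<close> extend to the one over
      \<open>D\<close>, but their supports lie in the disjoint sets \<open>D - C\<close> and
      \<open>C\<close>.\<close>
    then have "representation C x v = 0" for v
      using representation_ne_zero[of "D - C" x v] representation_ne_zero[of C x v] by auto
    moreover have "x = (\<Sum>v | representation C x v \<noteq> 0. representation C x v *\<^sub>R v)"
      using sum_nonzero_representation_eq[OF C(2) \<open>x \<in> span C\<close>] by simp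
    ultimately show "x = 0" by simp
  qed
  have "independent (f ` (D - C))"
    using linear_independent_injective_image[OF f independent_mono[OF D(3)] inj] by blast
  moreover have "f ` (D - C) \<subseteq> f ` S" using D(2) by auto
  moreover have "f ` S \<subseteq> span (f ` (D - C))"
  proof -
    have "f ` S \<subseteq> f ` span D" using D(4) by auto
    also have "\<dots> = span (f ` D)" using linear_span_image[OF f] by simp
    also have "\<dots> \<subseteq> span (f ` (D - C))"
    proof (rule span_minimal)
      show "f ` D \<subseteq> span (f ` (D - C))"
      proof
        fix y assume "y \<in> f ` D"
        then obtain x where x: "x \<in> D" "y = f x" by auto
        show "y \<in> span (f ` (D - C))"
        proof (cases "x \<in> C")
          case True
          then show ?thesis using C(1) x by (auto simp: K_def span_zero)
        qed (use x in \<open>auto intro: span_base\<close>)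
      qed
    qed simp
    finally show ?thesis .
  qed
  ultimately have "dim (f ` S) = card (f ` (D - C))"
    using basis_card_eq_dim by metis
  also have "\<dots> = card (D - C)"
    using inj by (intro card_image) (meson inj_on_subset span_superset)
  finally have "dim (f ` S) = card D - card C"
    using card_Diff_subset[OF C(4) D(1)] by simp
  moreover have "card C \<le> card D" using card_mono[OF finD D(1)] .
  ultimately show ?thesis using dimS C(5) by (simp add: K_def)
qed

lemma dim_image_inj:
  fixes f :: "'a::real_vector \<Rightarrow> 'b::real_vector"
  assumes "finite B" "S \<subseteq> span B" "subspace S" "linear f"
    and "\<And>x. x \<in> S \<Longrightarrow> f x = 0 \<Longrightarrow> x = 0"
  shows "dim (f ` S) = dim S"
proof -
  have "{x \<in> S. f x = 0} = {0}"
    using assms by (auto simp: subspace_0 linear_0)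
  then show ?thesis using rank_nullity[OF assms(1-4)] by simp
qed

subsection \<open>Bilinearity and conjugation\<close>

lemma cd_pair_add: "cd_pair n (a + a') (b + b') = cd_pair n a b + cd_pair n a' b'"
  and cd_pair_uminus: "cd_pair n (- a) (- b) = - cd_pair n a b"
  and cd_pair_scaleR: "cd_pair n (r *\<^sub>R a) (r *\<^sub>R b) = r *\<^sub>R cd_pair n a b"
  and cd_pair_zero [simp]: "cd_pair n 0 0 = 0"
  by (auto intro!: poly_mapping_eqI simp: cd_pair.rep_eq lookup_add lookup_minus)

lemma cd_fst_add [simp]: "cd_fst n (x + y) = cd_fst n x + cd_fst n y"
  and cd_snd_add [simp]: "cd_snd n (x + y) = cd_snd n x + cd_snd n y"
  and cd_fst_scaleR [simp]: "cd_fst n (r *\<^sub>R x) = r *\<^sub>R cd_fst n x"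
  and cd_snd_scaleR [simp]: "cd_snd n (r *\<^sub>R x) = r *\<^sub>R cd_snd n x"
  by (auto intro!: poly_mapping_eqI simp: cd_fst.rep_eq cd_snd.rep_eq lookup_add)

lemma carrier_add [simp]: "x \<in> cd_carrier n \<Longrightarrow> y \<in> cd_carrier n \<Longrightarrow> x + y \<in> cd_carrier n"
  and carrier_diff [simp]: "x \<in> cd_carrier n \<Longrightarrow> y \<in> cd_carrier n \<Longrightarrow> x - y \<in> cd_carrier n"
  and carrier_scaleR [simp]: "x \<in> cd_carrier n \<Longrightarrow> r *\<^sub>R x \<in> cd_carrier n"
  and carrier_zero [simp]: "0 \<in> cd_carrier n"
  and carrier_real [simp]: "cd_real r \<in> cd_carrier n"
  by (auto simp: cd_carrier_iff lookup_add lookup_minus lookup_single when_def)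

lemmas [simp] = cd_mult_carrier cd_conj_carrier cd_fst_pair cd_snd_pair
  cd_mult_minus_left cd_mult_minus_right cd_conj_minus cd_conj_conj

lemma carrier_one [simp]: "1 \<in> cd_carrier n"
  using carrier_real[of 1 n] by simp

lemma cd_pair_eq_iff:
  assumes "a \<in> cd_carrier n" "b \<in> cd_carrier n" "c \<in> cd_carrier n" "d \<in> cd_carrier n"
  shows "cd_pair n a b = cd_pair n c d \<longleftrightarrow> a = c \<and> b = d"
  using assms by (metis cd_fst_pair cd_snd_pair)

lemma cd_pair_eq_0_iff:
  assumes "a \<in> cd_carrier n" "b \<in> cd_carrier n"
  shows "cd_pair n a b = 0 \<longleftrightarrow> a = 0 \<and> b = 0"
  using cd_pair_eq_iff[OF assms, of 0 0] by simp

lemma carrier_Suc_cases: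
  assumes "x \<in> cd_carrier (Suc n)"
  obtains a b where "a \<in> cd_carrier n" "b \<in> cd_carrier n" "x = cd_pair n a b"
  using assms by (metis cd_fst_carrier cd_pair_fst_snd cd_snd_carrier)

lemma cd_conj_pair [simp]:
  assumes "a \<in> cd_carrier n" "b \<in> cd_carrier n"
  shows "cd_conj (Suc n) (cd_pair n a b) = cd_pair n (cd_conj n a) (- b)"
  using assms by simp

lemma cd_mult_pair [simp]:
  assumes "a \<in> cd_carrier n" "b \<in> cd_carrier n" "c \<in> cd_carrier n" "d \<in> cd_carrier n"
  shows "cd_mult (Suc n) (cd_pair n a b) (cd_pair n c d) =
    cd_pair n (cd_mult n a c - cd_mult n (cd_conj n d) b) (cd_mult n d a + cd_mult n b (cd_conj n c))"
  using assms by (simp add: Let_def)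

lemma cd_conj_add [simp]: "cd_conj n (x + y) = cd_conj n x + cd_conj n y"
  by (induction n arbitrary: x y) (simp_all add: cd_pair_add[symmetric])

lemma cd_conj_diff [simp]: "cd_conj n (x - y) = cd_conj n x - cd_conj n y"
  using cd_conj_add[of n x "- y"] by (simp del: cd_conj_add)

lemma cd_conj_scaleR [simp]: "cd_conj n (r *\<^sub>R x) = r *\<^sub>R cd_conj n x"
  by (induction n arbitrary: x) (simp_all add: cd_pair_scaleR[symmetric])

lemma real_single_scaleR: "cd_real (r * s) = r *\<^sub>R cd_real s"
  by (auto intro!: poly_mapping_eqI simp: lookup_single when_def)

lemma cd_mult_add_left [simp]: "cd_mult n (x + y) z = cd_mult n x z + cd_mult n y z"
  and cd_mult_add_right [simp]: "cd_mult n z (x + y) = cd_mult n z x + cd_mult n z y"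
proof -
  have "cd_mult n (x + y) z = cd_mult n x z + cd_mult n y z \<and>
        cd_mult n z (x + y) = cd_mult n z x + cd_mult n z y"
    by (induction n arbitrary: x y z)
       (simp_all add: Let_def cd_pair_add[symmetric] single_add[symmetric] lookup_add algebra_simps)
  then show "cd_mult n (x + y) z = cd_mult n x z + cd_mult n y z"
    "cd_mult n z (x + y) = cd_mult n z x + cd_mult n z y" by auto
qed

lemma cd_mult_diff_left [simp]: "cd_mult n (x - y) z = cd_mult n x z - cd_mult n y z"
  using cd_mult_add_left[of n x "- y" z] by (simp del: cd_mult_add_left)

lemma cd_mult_diff_right [simp]: "cd_mult n z (x - y) = cd_mult n z x - cd_mult n z y"
  using cd_mult_add_right[of n z x "- y"] by (simp del: cd_mult_add_right)

lemma cd_mult_scaleR_left [simp]: "cd_mult n (r *\<^sub>R x) z = r *\<^sub>R cd_mult n x z"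
  and cd_mult_scaleR_right [simp]: "cd_mult n z (r *\<^sub>R x) = r *\<^sub>R cd_mult n z x"
proof -
  have "cd_mult n (r *\<^sub>R x) z = r *\<^sub>R cd_mult n x z \<and>
        cd_mult n z (r *\<^sub>R x) = r *\<^sub>R cd_mult n z x"
    by (induction n arbitrary: x z)
       (simp_all add: Let_def cd_pair_scaleR[symmetric] real_single_scaleR[symmetric] algebra_simps)
  then show "cd_mult n (r *\<^sub>R x) z = r *\<^sub>R cd_mult n x z"
    "cd_mult n z (r *\<^sub>R x) = r *\<^sub>R cd_mult n z x" by auto
qed

lemma cd_mult_zero [simp]: "cd_mult n 0 x = 0" "cd_mult n x 0 = 0"
  using cd_mult_scaleR_left[of n 0 0 x] cd_mult_scaleR_right[of n x 0 0] by simp_all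

lemma cd_conj_zero [simp]: "cd_conj n 0 = 0"
  using cd_conj_scaleR[of n 0 0] by simp

lemma linear_cd_fst: "linear (cd_fst n)" and linear_cd_snd: "linear (cd_snd n)"
  by (auto intro!: linearI)

lemma cd_conj_real [simp]: "cd_conj n (cd_real r) = cd_real r"
proof (induction n)
  case (Suc n)
  then show ?case
    using cd_conj_pair[of "cd_real r" n 0] by (simp add: cd_pair_real del: cd_conj.simps(2))
qed simp

lemma cd_mult_real_left [simp]: "x \<in> cd_carrier n \<Longrightarrow> cd_mult n (cd_real r) x = r *\<^sub>R x"
  and cd_mult_real_right [simp]: "x \<in> cd_carrier n \<Longrightarrow> cd_mult n x (cd_real r) = r *\<^sub>R x"
proof -
  have "cd_mult n (cd_real r) x = r *\<^sub>R x \<and> cd_mult n x (cd_real r) = r *\<^sub>R x"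
    if "x \<in> cd_carrier n"
    using that
  proof (induction n arbitrary: x)
    case 0
    then show ?case by (auto simp: cd_carrier_0 real_single_scaleR mult.commute)
  next
    case (Suc n)
    then obtain a b where "a \<in> cd_carrier n" "b \<in> cd_carrier n" "x = cd_pair n a b"
      by (elim carrier_Suc_cases)
    with Suc.IH show ?case
      using cd_mult_pair[of "cd_real r" n 0 a b] cd_mult_pair[of a n b "cd_real r" 0]
      by (simp add: cd_pair_real cd_pair_scaleR del: cd_mult.simps(2))
  qed
  then show "x \<in> cd_carrier n \<Longrightarrow> cd_mult n (cd_real r) x = r *\<^sub>R x"
    "x \<in> cd_carrier n \<Longrightarrow> cd_mult n x (cd_real r) = r *\<^sub>R x" by auto
qed

lemma cd_mult_one [simp]:
  "x \<in> cd_carrier n \<Longrightarrow> cd_mult n 1 x = x" "x \<in> cd_carrier n \<Longrightarrow> cd_mult n x 1 = x"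
  using cd_mult_real_left[of x n 1] cd_mult_real_right[of x n 1] by simp_all

lemma cd_conj_mult:
  "x \<in> cd_carrier n \<Longrightarrow> y \<in> cd_carrier n \<Longrightarrow> cd_conj n (cd_mult n x y) = cd_mult n (cd_conj n y) (cd_conj n x)"
proof (induction n arbitrary: x y)
  case 0
  then show ?case by (simp add: mult.commute)
next
  case (Suc n)
  obtain a b where x: "a \<in> cd_carrier n" "b \<in> cd_carrier n" "x = cd_pair n a b"
    using Suc.prems(1) by (elim carrier_Suc_cases)
  obtain c d where y: "c \<in> cd_carrier n" "d \<in> cd_carrier n" "y = cd_pair n c d"
    using Suc.prems(2) by (elim carrier_Suc_cases)
  show ?case
    using x y by (simp add: Suc.IH minus_diff_commute del: cd_mult.simps(2) cd_conj.simps(2))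
qed

subsection \<open>The inner product\<close>

definition cip :: "nat \<Rightarrow> cd \<Rightarrow> cd \<Rightarrow> real" where
  "cip n x y = (\<Sum>k<2 ^ n. Poly_Mapping.lookup x k * Poly_Mapping.lookup y k)"

lemma cip_add [simp]: "cip n (x + y) z = cip n x z + cip n y z" "cip n z (x + y) = cip n z x + cip n z y"
  and cip_diff [simp]: "cip n (x - y) z = cip n x z - cip n y z" "cip n z (x - y) = cip n z x - cip n z y"
  and cip_minus [simp]: "cip n (- x) z = - cip n x z" "cip n z (- x) = - cip n z x"
  and cip_scaleR [simp]: "cip n (r *\<^sub>R x) z = r * cip n x z" "cip n z (r *\<^sub>R x) = r * cip n z x"
  and cip_zero [simp]: "cip n 0 x = 0" "cip n x 0 = 0"
  by (simp_all add: cip_def lookup_add lookup_minus algebra_simps sum.distrib sum_subtractf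
      sum_negf sum_distrib_left)

lemma cip_commute: "cip n x y = cip n y x"
  by (simp add: cip_def mult.commute)

lemma cip_nonneg: "cip n x x \<ge> 0"
  by (simp add: cip_def sum_nonneg)

lemma cip_eq_0: "x \<in> cd_carrier n \<Longrightarrow> cip n x x = 0 \<longleftrightarrow> x = 0"
  by (subst cip_def, subst sum_nonneg_eq_0_iff)
     (auto simp: cd_carrier_iff intro!: poly_mapping_eqI, metis lessThan_iff not_le)

lemma cip_pair [simp]: "cip (Suc n) (cd_pair n a b) (cd_pair n c d) = cip n a c + cip n b d"
proof -
  have "cip (Suc n) (cd_pair n a b) (cd_pair n c d) =
    (\<Sum>k\<in>{0..<2 ^ n}. Poly_Mapping.lookup (cd_pair n a b) k * Poly_Mapping.lookup (cd_pair n c d) k) +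
    (\<Sum>k\<in>{2 ^ n..<2 ^ Suc n}. Poly_Mapping.lookup (cd_pair n a b) k * Poly_Mapping.lookup (cd_pair n c d) k)"
    unfolding cip_def lessThan_atLeast0 by (subst sum.atLeastLessThan_concat) auto
  also have "(\<Sum>k\<in>{2 ^ n..<2 ^ Suc n}. Poly_Mapping.lookup (cd_pair n a b) k * Poly_Mapping.lookup (cd_pair n c d) k) =
    (\<Sum>k\<in>{0..<2 ^ n}. Poly_Mapping.lookup (cd_pair n a b) (k + 2 ^ n) * Poly_Mapping.lookup (cd_pair n c d) (k + 2 ^ n))"
    using sum.shift_bounds_nat_ivl[of "\<lambda>k. Poly_Mapping.lookup (cd_pair n a b) k * Poly_Mapping.lookup (cd_pair n c d) k" 0 "2 ^ n" "2 ^ n"]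
    by (simp add: mult_2)
  finally show ?thesis
    by (simp add: cip_def lessThan_atLeast0 cd_pair.rep_eq)
qed

lemma cip_conj_conj: "x \<in> cd_carrier n \<Longrightarrow> y \<in> cd_carrier n \<Longrightarrow> cip n (cd_conj n x) (cd_conj n y) = cip n x y"
proof (induction n arbitrary: x y)
  case (Suc n)
  obtain a b where x: "a \<in> cd_carrier n" "b \<in> cd_carrier n" "x = cd_pair n a b"
    using Suc.prems(1) by (elim carrier_Suc_cases)
  obtain c d where y: "c \<in> cd_carrier n" "d \<in> cd_carrier n" "y = cd_pair n c d"
    using Suc.prems(2) by (elim carrier_Suc_cases)
  show ?case using x y by (simp add: Suc.IH del: cd_conj.simps(2))
qed simp

text \<open>Multiplication by x on either side has multiplication by x^* as adjoint. This needs no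
  associativity and replaces it in most orthogonality arguments.\<close>

lemma cip_mult_adjoint:
  assumes "x \<in> cd_carrier n" "y \<in> cd_carrier n" "z \<in> cd_carrier n"
  shows cip_mult_right_adjoint: "cip n (cd_mult n x y) z = cip n x (cd_mult n z (cd_conj n y))"
    and cip_mult_left_adjoint: "cip n (cd_mult n x y) z = cip n y (cd_mult n (cd_conj n x) z)"
proof -
  \<comment> \<open>Conjugation is an isometric antiautomorphism, so it turns the right rule into
    the left one at the same level. The induction for the right rule needs the left one because d
    stands to the left in the doubling formula.\<close>
  have left: "cip n (cd_mult n x y) z = cip n y (cd_mult n (cd_conj n x) z)"
    if right: "\<And>x y z. x \<in> cd_carrier n \<Longrightarrow> y \<in> cd_carrier n \<Longrightarrow> z \<in> cd_carrier n \<Longrightarrow>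
      cip n (cd_mult n x y) z = cip n x (cd_mult n z (cd_conj n y))"
    and c: "x \<in> cd_carrier n" "y \<in> cd_carrier n" "z \<in> cd_carrier n" for n x y z
  proof -
    have "cip n (cd_mult n x y) z = cip n (cd_mult n (cd_conj n y) (cd_conj n x)) (cd_conj n z)"
      using cip_conj_conj[of "cd_mult n x y" n z] c by (simp add: cd_conj_mult)
    also have "\<dots> = cip n (cd_conj n y) (cd_mult n (cd_conj n z) x)"
      using c by (simp add: right)
    also have "\<dots> = cip n y (cd_mult n (cd_conj n x) z)"
      using cip_conj_conj[of y n "cd_mult n (cd_conj n x) z"] c by (simp add: cd_conj_mult)
    finally show ?thesis .
  qed
  have right: "cip n (cd_mult n x y) z = cip n x (cd_mult n z (cd_conj n y))"
    if "x \<in> cd_carrier n" "y \<in> cd_carrier n" "z \<in> cd_carrier n" for x y z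
    using that
  proof (induction n arbitrary: x y z)
    case 0
    then show ?case by (simp add: cip_def)
  next
    case (Suc n)
    obtain a b where x: "a \<in> cd_carrier n" "b \<in> cd_carrier n" "x = cd_pair n a b"
      using Suc.prems(1) by (elim carrier_Suc_cases)
    obtain c d where y: "c \<in> cd_carrier n" "d \<in> cd_carrier n" "y = cd_pair n c d"
      using Suc.prems(2) by (elim carrier_Suc_cases)
    obtain e f where z: "e \<in> cd_carrier n" "f \<in> cd_carrier n" "z = cd_pair n e f"
      using Suc.prems(3) by (elim carrier_Suc_cases)
    have "cip n (cd_mult n a c) e = cip n a (cd_mult n e (cd_conj n c))"
      "cip n (cd_mult n b (cd_conj n c)) f = cip n b (cd_mult n f c)"
      "cip n (cd_mult n d a) f = cip n a (cd_mult n (cd_conj n d) f)"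
      "cip n (cd_mult n (cd_conj n d) b) e = cip n b (cd_mult n d e)"
      using Suc.IH[of a c e] Suc.IH[of b "cd_conj n c" f] left[OF Suc.IH, of d a f]
        left[OF Suc.IH, of "cd_conj n d" b e] x y z by simp_all
    with x y z show ?case by (simp del: cd_mult.simps(2) cd_conj.simps(2))
  qed
  show "cip n (cd_mult n x y) z = cip n x (cd_mult n z (cd_conj n y))"
    using right assms by blast
  show "cip n (cd_mult n x y) z = cip n y (cd_mult n (cd_conj n x) z)"
    using left[OF right assms] by blast
qed

lemma lookup_conj_0: "x \<in> cd_carrier n \<Longrightarrow> Poly_Mapping.lookup (cd_conj n x) 0 = Poly_Mapping.lookup x 0"
  by (induction n arbitrary: x) (auto simp: cd_pair.rep_eq cd_fst.rep_eq)

lemma cip_real_left [simp]: "cip n (cd_real r) x = r * Poly_Mapping.lookup x 0"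
proof -
  have "cip n (cd_real r) x = (\<Sum>k<(2::nat) ^ n. if k = 0 then r * Poly_Mapping.lookup x 0 else 0)"
    unfolding cip_def by (rule sum.cong) (auto simp: lookup_single when_def)
  then show ?thesis by simp
qed

lemma lookup_mult_0:
  assumes "x \<in> cd_carrier n" "y \<in> cd_carrier n"
  shows "Poly_Mapping.lookup (cd_mult n x y) 0 = cip n x (cd_conj n y)"
  using cip_mult_right_adjoint[OF assms, of "cd_real 1"] assms cip_real_left[of n 1 "cd_mult n x y"]
  by (simp add: cip_commute)

lemma cd_mult_conj_self:
  assumes "x \<in> cd_carrier n"
  shows "cd_mult n x (cd_conj n x) = cd_real (cip n x x)"
    and "cd_mult n (cd_conj n x) x = cd_real (cip n x x)"
proof -
  have *: "cd_mult n x (cd_conj n x) = cd_real (cip n x x)" if x: "x \<in> cd_carrier n" for x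
  proof -
    obtain r where "cd_mult n x (cd_conj n x) = cd_real r"
      using cd_mult_conj_real[OF x] by blast
    moreover have "Poly_Mapping.lookup (cd_mult n x (cd_conj n x)) 0 = cip n x x"
      using x lookup_mult_0[of x n "cd_conj n x"] by simp
    ultimately show ?thesis by simp
  qed
  show "cd_mult n x (cd_conj n x) = cd_real (cip n x x)" using *[OF assms] .
  show "cd_mult n (cd_conj n x) x = cd_real (cip n x x)"
    using *[of "cd_conj n x"] assms by (simp add: cip_conj_conj)
qed

lemma cd_norm_cip: "x \<in> cd_carrier n \<Longrightarrow> cd_norm n x = sqrt (cip n x x)"
  by (simp add: cd_norm_def cd_mult_conj_self)

subsection \<open>Octonions\<close>

definition cd_assoc :: "nat \<Rightarrow> bool" where
  "cd_assoc n \<longleftrightarrow> (\<forall>x\<in>cd_carrier n. \<forall>y\<in>cd_carrier n. \<forall>z\<in>cd_carrier n.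
     cd_mult n (cd_mult n x y) z = cd_mult n x (cd_mult n y z))"

definition cd_comm :: "nat \<Rightarrow> bool" where
  "cd_comm n \<longleftrightarrow> (\<forall>x\<in>cd_carrier n. \<forall>y\<in>cd_carrier n. cd_mult n x y = cd_mult n y x)"

lemma cd_assoc_Suc:
  assumes "cd_assoc n" "cd_comm n"
  shows "cd_assoc (Suc n)"
  unfolding cd_assoc_def
proof (intro ballI)
  fix x y z assume *: "x \<in> cd_carrier (Suc n)" "y \<in> cd_carrier (Suc n)" "z \<in> cd_carrier (Suc n)"
  obtain a b where x: "a \<in> cd_carrier n" "b \<in> cd_carrier n" "x = cd_pair n a b"
    using *(1) by (elim carrier_Suc_cases)
  obtain c d where y: "c \<in> cd_carrier n" "d \<in> cd_carrier n" "y = cd_pair n c d"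
    using *(2) by (elim carrier_Suc_cases)
  obtain e f where z: "e \<in> cd_carrier n" "f \<in> cd_carrier n" "z = cd_pair n e f"
    using *(3) by (elim carrier_Suc_cases)
  have A: "cd_mult n (cd_mult n u v) w = cd_mult n u (cd_mult n v w)"
    if "u \<in> cd_carrier n" "v \<in> cd_carrier n" "w \<in> cd_carrier n" for u v w
    using assms(1) that by (auto simp: cd_assoc_def)
  have C: "cd_mult n u v = cd_mult n v u" if "u \<in> cd_carrier n" "v \<in> cd_carrier n" for u v
    using assms(2) that by (auto simp: cd_comm_def)
  have L: "cd_mult n u (cd_mult n v w) = cd_mult n v (cd_mult n u w)"
    if "u \<in> cd_carrier n" "v \<in> cd_carrier n" "w \<in> cd_carrier n" for u v w
    using A[of u v w] A[of v u w] C[of u v] that by simp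
  show "cd_mult (Suc n) (cd_mult (Suc n) x y) z = cd_mult (Suc n) x (cd_mult (Suc n) y z)"
    using x y z by (simp add: cd_conj_mult A C L algebra_simps del: cd_mult.simps(2) cd_conj.simps(2))
qed

lemma cd_assoc_2: "cd_assoc 2"
proof -
  have a0: "cd_assoc 0" and c0: "cd_comm 0"
    by (simp_all add: cd_assoc_def cd_comm_def mult_ac)
  have "cd_comm (Suc 0)"
    unfolding cd_comm_def
  proof (intro ballI)
    fix x y assume *: "x \<in> cd_carrier (Suc 0)" "y \<in> cd_carrier (Suc 0)"
    obtain a b where x: "a \<in> cd_carrier 0" "b \<in> cd_carrier 0" "x = cd_pair 0 a b"
      using *(1) by (elim carrier_Suc_cases)
    obtain c d where y: "c \<in> cd_carrier 0" "d \<in> cd_carrier 0" "y = cd_pair 0 c d"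
      using *(2) by (elim carrier_Suc_cases)
    \<comment> \<open>Conjugation on A_0 is trivial, so the product of A_1 is symmetric once real
      numbers commute.\<close>
    have C: "cd_mult 0 u v = cd_mult 0 v u" for u v by (simp add: mult.commute)
    show "cd_mult (Suc 0) x y = cd_mult (Suc 0) y x"
      using x y by (simp add: C add.commute del: cd_mult.simps cd_conj.simps(2))
  qed
  then have "cd_assoc (Suc (Suc 0))"
    using cd_assoc_Suc a0 c0 by blast
  then show ?thesis by (simp add: numeral_2_eq_2)
qed

text \<open>The double of an associative algebra is alternative; only associativity one level below
  and the fact that a a^* is real are used. At n = 2 it shows that octonions have no zero
  divisors.\<close>

lemma cd_conj_mult_mult:
  assumes "cd_assoc n" "x \<in> cd_carrier (Suc n)" "y \<in> cd_carrier (Suc n)"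
  shows "cd_mult (Suc n) (cd_conj (Suc n) x) (cd_mult (Suc n) x y) = cip (Suc n) x x *\<^sub>R y"
proof -
  obtain a b where x: "a \<in> cd_carrier n" "b \<in> cd_carrier n" "x = cd_pair n a b"
    using assms(2) by (elim carrier_Suc_cases)
  obtain c d where y: "c \<in> cd_carrier n" "d \<in> cd_carrier n" "y = cd_pair n c d"
    using assms(3) by (elim carrier_Suc_cases)
  have A: "cd_mult n (cd_mult n u v) w = cd_mult n u (cd_mult n v w)"
    if "u \<in> cd_carrier n" "v \<in> cd_carrier n" "w \<in> cd_carrier n" for u v w
    using assms(1) that by (auto simp: cd_assoc_def)
  have L: "cd_mult n (cd_conj n u) (cd_mult n u v) = cip n u u *\<^sub>R v"
      "cd_mult n u (cd_mult n (cd_conj n u) v) = cip n u u *\<^sub>R v"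
    if "u \<in> cd_carrier n" "v \<in> cd_carrier n" for u v
    using A[of "cd_conj n u" u v] A[of u "cd_conj n u" v] that by (simp_all add: cd_mult_conj_self)
  show ?thesis
    using x y by (simp add: cd_conj_mult A L cd_mult_conj_self cd_pair_add cd_pair_scaleR[symmetric]
        algebra_simps del: cd_mult.simps(2) cd_conj.simps(2))
qed

lemma cd_Ann_octonion:
  assumes "x \<in> cd_carrier 3" "x \<noteq> 0"
  shows "cd_Ann 3 x = {0}"
proof -
  have "y = 0" if "y \<in> cd_carrier 3" "cd_mult 3 x y = 0" for y
    using cd_conj_mult_mult[OF cd_assoc_2, of x y] that assms cip_eq_0[of x 3] by simp
  then show ?thesis by (auto simp: cd_Ann_def)
qed

subsection \<open>The complex structure\<close>

definition cd_emb :: "nat \<Rightarrow> complex \<Rightarrow> cd" where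
  "cd_emb n z = cd_real (Re z) + Im z *\<^sub>R cd_i n"

text \<open>Since i_n = (0,1), its only nonzero coordinate has index 2^(n-1), the first one of the
  second block.\<close>

definition cd_prj :: "nat \<Rightarrow> cd \<Rightarrow> complex" where
  "cd_prj n x = Complex (Poly_Mapping.lookup x 0) (Poly_Mapping.lookup x (2 ^ (n - 1)))"

text \<open>C_n is spanned by two coordinate vectors, so its orthogonal complement is given by the
  vanishing of two coordinates; orthogonality for \<open>cip\<close> is
  \<open>cip_perp_emb\<close>.\<close>

definition cd_perp :: "nat \<Rightarrow> cd set" where
  "cd_perp n = {x \<in> cd_carrier n. cd_prj n x = 0}"

lemma cd_i_Suc_lookup: "Poly_Mapping.lookup (cd_i (Suc m)) k = (if k = 2 ^ m then 1 else 0)"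
  by (auto simp: cd_pair.rep_eq lookup_one when_def)

lemma cd_conj_imaginary:
  "x \<in> cd_carrier n \<Longrightarrow> Poly_Mapping.lookup x 0 = 0 \<Longrightarrow> cd_conj n x = - x"
proof (induction n arbitrary: x)
  case 0
  then show ?case by (auto simp: cd_carrier_0)
next
  case (Suc n)
  obtain a b where x: "a \<in> cd_carrier n" "b \<in> cd_carrier n" "x = cd_pair n a b"
    using Suc.prems(1) by (elim carrier_Suc_cases)
  then have "Poly_Mapping.lookup a 0 = 0" using Suc.prems(2) by (simp add: cd_pair.rep_eq)
  with Suc.IH[of a] x show ?case by (simp add: cd_pair_uminus del: cd_conj.simps(2))
qed

lemma cd_i_carrier [simp]: "cd_i n \<in> cd_carrier n"
  by (cases n) auto

lemma cd_prj_add [simp]: "cd_prj n (x + y) = cd_prj n x + cd_prj n y"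
  and cd_prj_diff [simp]: "cd_prj n (x - y) = cd_prj n x - cd_prj n y"
  and cd_prj_minus [simp]: "cd_prj n (- x) = - cd_prj n x"
  and cd_prj_scaleR [simp]: "cd_prj n (r *\<^sub>R x) = r *\<^sub>R cd_prj n x"
  and cd_prj_zero [simp]: "cd_prj n 0 = 0"
  by (simp_all add: cd_prj_def lookup_add lookup_minus complex_eq_iff)

lemma cd_emb_add: "cd_emb n (z + w) = cd_emb n z + cd_emb n w"
  and cd_emb_diff: "cd_emb n (z - w) = cd_emb n z - cd_emb n w"
  and cd_emb_minus: "cd_emb n (- z) = - cd_emb n z"
  and cd_emb_scaleR: "cd_emb n (r *\<^sub>R z) = r *\<^sub>R cd_emb n z"
  and cd_emb_zero [simp]: "cd_emb n 0 = 0"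
  using real_single_scaleR[of r "Re z"]
  by (simp_all add: cd_emb_def single_add single_diff single_uminus scaleR_add_right
      scaleR_add_left scaleR_diff_left)

lemma cd_emb_carrier [simp]: "cd_emb n z \<in> cd_carrier n"
  by (simp add: cd_emb_def)

lemma cd_perp_add [simp]: "x \<in> cd_perp n \<Longrightarrow> y \<in> cd_perp n \<Longrightarrow> x + y \<in> cd_perp n"
  and cd_perp_diff [simp]: "x \<in> cd_perp n \<Longrightarrow> y \<in> cd_perp n \<Longrightarrow> x - y \<in> cd_perp n"
  and cd_perp_minus [simp]: "x \<in> cd_perp n \<Longrightarrow> - x \<in> cd_perp n"
  and cd_perp_scaleR [simp]: "x \<in> cd_perp n \<Longrightarrow> r *\<^sub>R x \<in> cd_perp n"
  and cd_perp_zero [simp]: "0 \<in> cd_perp n"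
  by (simp_all add: cd_perp_def)

lemma cd_perpI: "x \<in> cd_carrier n \<Longrightarrow> cd_prj n x = 0 \<Longrightarrow> x \<in> cd_perp n"
  and cd_perp_carrier [simp]: "x \<in> cd_perp n \<Longrightarrow> x \<in> cd_carrier n"
  and cd_perp_prj [simp]: "x \<in> cd_perp n \<Longrightarrow> cd_prj n x = 0"
  by (simp_all add: cd_perp_def)

lemma cd_perp_lookup: "x \<in> cd_perp n \<Longrightarrow> Poly_Mapping.lookup x 0 = 0"
  by (drule cd_perp_prj) (simp add: cd_prj_def complex_eq_iff)

lemma cd_perp_conj [simp]: "x \<in> cd_perp n \<Longrightarrow> cd_conj n x = - x"
  by (rule cd_conj_imaginary) (auto simp: cd_perp_lookup)

lemma cd_prj_conj: "x \<in> cd_carrier n \<Longrightarrow> 0 < n \<Longrightarrow> cd_prj n (cd_conj n x) = cnj (cd_prj n x)"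
proof (cases n)
  case (Suc m)
  assume "x \<in> cd_carrier n"
  with Suc obtain a b where "a \<in> cd_carrier m" "b \<in> cd_carrier m" "x = cd_pair m a b"
    by (auto elim: carrier_Suc_cases)
  with Suc show ?thesis
    by (simp add: cd_prj_def cd_pair.rep_eq complex_eq_iff lookup_conj_0 del: cd_conj.simps(2))
qed simp

abbreviation cd_J :: "nat \<Rightarrow> cd \<Rightarrow> cd" where
  "cd_J n x \<equiv> cd_mult n (cd_i n) x"

lemma cd_J_pair:
  "a \<in> cd_carrier m \<Longrightarrow> b \<in> cd_carrier m \<Longrightarrow>
    cd_J (Suc m) (cd_pair m a b) = cd_pair m (- cd_conj m b) (cd_conj m a)"
  by (simp del: cd_mult.simps(2))

lemma cd_mult_i_pair:
  "a \<in> cd_carrier m \<Longrightarrow> b \<in> cd_carrier m \<Longrightarrow>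
    cd_mult (Suc m) (cd_pair m a b) (cd_i (Suc m)) = cd_pair m (- b) a"
  using cd_conj_real[of m 1] by (simp del: cd_mult.simps(2))

lemma cd_perp_Suc_iff:
  "x \<in> cd_perp (Suc m) \<longleftrightarrow> (\<exists>a b. x = cd_pair m a b \<and> a \<in> cd_carrier m \<and> b \<in> cd_carrier m \<and>
     Poly_Mapping.lookup a 0 = 0 \<and> Poly_Mapping.lookup b 0 = 0)"
proof
  assume x: "x \<in> cd_perp (Suc m)"
  then obtain a b where ab: "x = cd_pair m a b" "a \<in> cd_carrier m" "b \<in> cd_carrier m"
    using carrier_Suc_cases[OF cd_perp_carrier[OF x]] by blast
  moreover have "Poly_Mapping.lookup a 0 = 0 \<and> Poly_Mapping.lookup b 0 = 0"
    using cd_perp_prj[OF x] ab(1) by (simp add: cd_prj_def complex_eq_iff cd_pair.rep_eq)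
  ultimately show "\<exists>a b. x = cd_pair m a b \<and> a \<in> cd_carrier m \<and> b \<in> cd_carrier m \<and>
     Poly_Mapping.lookup a 0 = 0 \<and> Poly_Mapping.lookup b 0 = 0" by blast
qed (auto intro!: cd_perpI simp: cd_prj_def complex_eq_iff cd_pair.rep_eq)

text \<open>Only on \<open>cd_perp n\<close> is this a Hermitian form. It is defined on all of A_n,
  so that real bilinearity holds without side conditions.\<close>

definition cd_H :: "nat \<Rightarrow> cd \<Rightarrow> cd \<Rightarrow> complex" where
  "cd_H n x y = cd_prj n (cd_mult n x y)"

definition cd_circ :: "nat \<Rightarrow> cd \<Rightarrow> cd \<Rightarrow> cd" where
  "cd_circ n x y = cd_mult n x y - cd_emb n (cd_H n x y)"

definition cd_sc :: "nat \<Rightarrow> complex \<Rightarrow> cd \<Rightarrow> cd" where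
  "cd_sc n z x = Re z *\<^sub>R x + Im z *\<^sub>R cd_J n x"

lemma cd_H_add [simp]: "cd_H n (x + y) z = cd_H n x z + cd_H n y z" "cd_H n z (x + y) = cd_H n z x + cd_H n z y"
  and cd_H_diff [simp]: "cd_H n (x - y) z = cd_H n x z - cd_H n y z" "cd_H n z (x - y) = cd_H n z x - cd_H n z y"
  and cd_H_minus [simp]: "cd_H n (- x) z = - cd_H n x z" "cd_H n z (- x) = - cd_H n z x"
  and cd_H_scaleR [simp]: "cd_H n (r *\<^sub>R x) z = r *\<^sub>R cd_H n x z" "cd_H n z (r *\<^sub>R x) = r *\<^sub>R cd_H n z x"
  and cd_H_zero [simp]: "cd_H n 0 z = 0" "cd_H n z 0 = 0"
  by (simp_all add: cd_H_def)

lemma cd_circ_add [simp]: "cd_circ n (x + y) z = cd_circ n x z + cd_circ n y z" "cd_circ n z (x + y) = cd_circ n z x + cd_circ n z y"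
  and cd_circ_diff [simp]: "cd_circ n (x - y) z = cd_circ n x z - cd_circ n y z" "cd_circ n z (x - y) = cd_circ n z x - cd_circ n z y"
  and cd_circ_minus [simp]: "cd_circ n (- x) z = - cd_circ n x z" "cd_circ n z (- x) = - cd_circ n z x"
  and cd_circ_scaleR [simp]: "cd_circ n (r *\<^sub>R x) z = r *\<^sub>R cd_circ n x z" "cd_circ n z (r *\<^sub>R x) = r *\<^sub>R cd_circ n z x"
  and cd_circ_zero [simp]: "cd_circ n 0 z = 0" "cd_circ n z 0 = 0"
  by (simp_all add: cd_circ_def cd_emb_add cd_emb_diff cd_emb_minus cd_emb_scaleR algebra_simps)

lemma cd_mult_split: "cd_mult n x y = cd_emb n (cd_H n x y) + cd_circ n x y"
  by (simp add: cd_circ_def)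

text \<open>At level 0 the element \<open>cd_i 0\<close> is the dummy 0 and \<open>cd_J\<close>
  would not square to -1. The locale is used at n and at \<open>Suc n\<close>.\<close>

locale cd_level =
  fixes n :: nat
  assumes n_pos: "0 < n"
begin

lemma carrier_pair_cases:
  assumes "x \<in> cd_carrier n"
  obtains m a b where "n = Suc m" "a \<in> cd_carrier m" "b \<in> cd_carrier m" "x = cd_pair m a b"
proof -
  obtain m where "n = Suc m" using n_pos gr0_implies_Suc by blast
  with assms that show thesis by (auto elim: carrier_Suc_cases)
qed

lemma prj_real [simp]: "cd_prj n (cd_real r) = complex_of_real r"
  by (simp add: cd_prj_def complex_eq_iff lookup_single when_def)

lemma prj_i [simp]: "cd_prj n (cd_i n) = \<i>"
proof -
  obtain m where "n = Suc m" using n_pos gr0_implies_Suc by blast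
  then show ?thesis
    by (simp add: cd_prj_def complex_eq_iff cd_i_Suc_lookup del: cd_i.simps)
qed

lemma prj_emb [simp]: "cd_prj n (cd_emb n z) = z"
  by (simp add: cd_emb_def complex_eq_iff)

lemma J_J [simp]: "x \<in> cd_carrier n \<Longrightarrow> cd_J n (cd_J n x) = - x"
  by (erule carrier_pair_cases)
     (simp add: cd_J_pair cd_pair_uminus del: cd_mult.simps(2) cd_mult_pair cd_i.simps)

lemma prj_J [simp]: "x \<in> cd_carrier n \<Longrightarrow> cd_prj n (cd_J n x) = \<i> * cd_prj n x"
  by (erule carrier_pair_cases)
     (simp add: cd_J_pair cd_prj_def cd_pair.rep_eq complex_eq_iff lookup_conj_0
       del: cd_mult.simps(2) cd_mult_pair cd_i.simps)

lemma J_perp [simp]: "x \<in> cd_perp n \<Longrightarrow> cd_J n x \<in> cd_perp n"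
  by (rule cd_perpI) simp_all

lemma sc_perp [simp]: "x \<in> cd_perp n \<Longrightarrow> cd_sc n z x \<in> cd_perp n"
  by (simp add: cd_sc_def)

lemma J_emb: "cd_J n (cd_emb n z) = cd_emb n (\<i> * z)"
proof -
  have "cd_J n (cd_i n) = - 1"
    using J_J[of 1] by simp
  then show ?thesis
    by (simp add: cd_emb_def single_uminus real_single_scaleR[of _ 1, simplified] algebra_simps)
qed

lemma emb_mult: "x \<in> cd_carrier n \<Longrightarrow> cd_mult n (cd_emb n z) x = cd_sc n z x"
  by (simp add: cd_emb_def cd_sc_def)

lemma emb_mult_emb: "cd_mult n (cd_emb n z) (cd_emb n w) = cd_emb n (z * w)"
  by (simp add: emb_mult cd_sc_def J_emb cd_emb_scaleR[symmetric] cd_emb_add[symmetric])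
     (rule arg_cong[where f = "cd_emb n"], simp add: complex_eq_iff)

lemma perp_mult_i: "x \<in> cd_perp n \<Longrightarrow> cd_mult n x (cd_i n) = - cd_J n x"
proof -
  assume x: "x \<in> cd_perp n"
  obtain m where n: "n = Suc m" using n_pos gr0_implies_Suc by blast
  from x n obtain a b where "x = cd_pair m a b" "a \<in> cd_carrier m" "b \<in> cd_carrier m"
     "Poly_Mapping.lookup a 0 = 0" "Poly_Mapping.lookup b 0 = 0"
    by (auto simp: cd_perp_Suc_iff)
  with n show ?thesis
    by (simp add: cd_J_pair cd_mult_i_pair cd_conj_imaginary cd_pair_uminus[symmetric]
        del: cd_mult.simps(2) cd_mult_pair cd_i.simps)
qed

lemma perp_mult_emb: "x \<in> cd_perp n \<Longrightarrow> cd_mult n x (cd_emb n z) = cd_sc n (cnj z) x"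
  by (simp add: cd_emb_def cd_sc_def perp_mult_i)

lemma emb_mult_i: "cd_mult n (cd_emb n z) (cd_i n) = cd_emb n (\<i> * z)"
  using emb_mult_emb[of z \<i>] by (simp add: cd_emb_def[of n \<i>] mult.commute)

text \<open>The two rules that replace associativity for the complex structure, checked by expanding
  pairs of imaginary elements.\<close>

lemma J_mult:
  assumes "x \<in> cd_perp n" "y \<in> cd_perp n"
  shows "cd_mult n (cd_J n x) y = cd_mult n (cd_mult n x y) (cd_i n)"
    and "cd_mult n x (cd_J n y) = - cd_J n (cd_mult n x y)"
proof -
  obtain m where n: "n = Suc m" using n_pos gr0_implies_Suc by blast
  from assms(1) n obtain a b where x: "x = cd_pair m a b" "a \<in> cd_carrier m" "b \<in> cd_carrier m"
     "Poly_Mapping.lookup a 0 = 0" "Poly_Mapping.lookup b 0 = 0"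
    by (auto simp: cd_perp_Suc_iff)
  from assms(2) n obtain c d where y: "y = cd_pair m c d" "c \<in> cd_carrier m" "d \<in> cd_carrier m"
     "Poly_Mapping.lookup c 0 = 0" "Poly_Mapping.lookup d 0 = 0"
    by (auto simp: cd_perp_Suc_iff)
  have i: "cd_i (Suc m) = cd_pair m 0 1" by simp
  show "cd_mult n (cd_J n x) y = cd_mult n (cd_mult n x y) (cd_i n)"
    "cd_mult n x (cd_J n y) = - cd_J n (cd_mult n x y)"
    using x y n cd_conj_real[of m 1]
    by (simp_all add: i cd_conj_mult cd_conj_imaginary cd_pair_uminus[symmetric] add.commute
        del: cd_mult.simps(2) cd_i.simps)
qed

lemma circ_perp [simp]: "cd_circ n x y \<in> cd_perp n"
  by (rule cd_perpI) (simp_all add: cd_circ_def cd_H_def)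

lemma split_eq_iff:
  assumes "u \<in> cd_perp n" "v \<in> cd_perp n"
  shows "cd_emb n z + u = cd_emb n w + v \<longleftrightarrow> z = w \<and> u = v"
proof
  assume *: "cd_emb n z + u = cd_emb n w + v"
  then have "cd_prj n (cd_emb n z + u) = cd_prj n (cd_emb n w + v)" by simp
  then have "z = w" using assms by simp
  with * show "z = w \<and> u = v" by simp
qed auto

text \<open>Compare the two components of each rule in \<open>J_mult\<close>. Right multiplication
  by i_n is multiplication by i on C_n but -J on the complement, which makes \<open>cd_circ\<close>
  conjugate-linear in its first argument too.\<close>

lemma J_bilinear:
  assumes "x \<in> cd_perp n" "y \<in> cd_perp n"
  shows H_J_left: "cd_H n (cd_J n x) y = \<i> * cd_H n x y"
    and circ_J_left: "cd_circ n (cd_J n x) y = - cd_J n (cd_circ n x y)"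
    and H_J_right: "cd_H n x (cd_J n y) = - (\<i> * cd_H n x y)"
    and circ_J_right: "cd_circ n x (cd_J n y) = - cd_J n (cd_circ n x y)"
proof -
  have "cd_emb n (cd_H n (cd_J n x) y) + cd_circ n (cd_J n x) y =
      cd_emb n (\<i> * cd_H n x y) + - cd_J n (cd_circ n x y)"
    using J_mult(1)[OF assms] unfolding cd_mult_split[of n "cd_J n x" y] cd_mult_split[of n x y]
    by (simp add: emb_mult_i perp_mult_i)
  then show "cd_H n (cd_J n x) y = \<i> * cd_H n x y" "cd_circ n (cd_J n x) y = - cd_J n (cd_circ n x y)"
    using assms by (simp_all only: split_eq_iff circ_perp J_perp cd_perp_minus)
  have "cd_emb n (cd_H n x (cd_J n y)) + cd_circ n x (cd_J n y) =
      cd_emb n (- (\<i> * cd_H n x y)) + - cd_J n (cd_circ n x y)"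
    using J_mult(2)[OF assms] unfolding cd_mult_split[of n x "cd_J n y"] cd_mult_split[of n x y]
    by (simp add: J_emb cd_emb_minus)
  then show "cd_H n x (cd_J n y) = - (\<i> * cd_H n x y)" "cd_circ n x (cd_J n y) = - cd_J n (cd_circ n x y)"
    using assms by (simp_all only: split_eq_iff circ_perp J_perp cd_perp_minus)
qed

lemma H_sc_left: "x \<in> cd_perp n \<Longrightarrow> y \<in> cd_perp n \<Longrightarrow> cd_H n (cd_sc n z x) y = z * cd_H n x y"
  and H_sc_right: "x \<in> cd_perp n \<Longrightarrow> y \<in> cd_perp n \<Longrightarrow> cd_H n x (cd_sc n z y) = cnj z * cd_H n x y"
  by (simp_all add: cd_sc_def J_bilinear complex_eq_iff)

lemma H_commute:
  assumes "x \<in> cd_perp n" "y \<in> cd_perp n"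
  shows "cd_H n y x = cnj (cd_H n x y)" and circ_commute: "cd_circ n y x = - cd_circ n x y"
proof -
  \<comment> \<open>The two signs from x^* = -x and y^* = -y cancel. Conjugation acts on C_n as
    complex conjugation and on the complement as -1, whence the different symmetries.\<close>
  have *: "cd_mult n y x = cd_conj n (cd_mult n x y)"
    using assms by (simp add: cd_conj_mult)
  show "cd_H n y x = cnj (cd_H n x y)"
    unfolding cd_H_def * using n_pos by (simp add: cd_prj_conj)
  have "cd_conj n (cd_emb n z) = cd_emb n (cnj z)" for z
  proof -
    have "Poly_Mapping.lookup (cd_i n) 0 = 0"
      using arg_cong[OF prj_i, of Re] by (simp add: cd_prj_def)
    then show ?thesis by (simp add: cd_emb_def cd_conj_imaginary)
  qed
  then show "cd_circ n y x = - cd_circ n x y"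
    using * \<open>cd_H n y x = cnj (cd_H n x y)\<close>
    by (simp add: cd_mult_split[of n x y] cd_circ_def[of n y x])
qed

lemma circ_self [simp]: "x \<in> cd_perp n \<Longrightarrow> cd_circ n x x = 0"
  using circ_commute[of x x] by (simp add: equal_neg_zero)

lemma Re_H: "x \<in> cd_perp n \<Longrightarrow> y \<in> cd_perp n \<Longrightarrow> Re (cd_H n x y) = - cip n x y"
  using lookup_mult_0[of x n y] by (simp add: cd_H_def cd_prj_def)

lemma H_self: "x \<in> cd_perp n \<Longrightarrow> cd_H n x x = - complex_of_real (cip n x x)"
  using Re_H[of x x] H_commute[of x x] by (simp add: complex_eq_iff)

lemma cip_perp_emb:
  assumes "x \<in> cd_perp n" shows "cip n x (cd_emb n z) = 0"
proof -
  have "cip n x (cd_i n) = cip n (cd_mult n x (cd_conj n (cd_i n))) 1"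
    using cip_mult_right_adjoint[of 1 n "cd_i n" x] assms by (simp add: cip_commute)
  also have "\<dots> = Poly_Mapping.lookup (cd_J n x) 0"
  proof -
    have "cd_conj n (cd_i n) = - cd_i n"
      using arg_cong[OF prj_i, of Re] by (simp add: cd_prj_def cd_conj_imaginary)
    then show ?thesis
      using assms cip_real_left[of n 1 "cd_J n x"] by (simp add: perp_mult_i cip_commute)
  qed
  also have "\<dots> = 0"
    using cd_perp_lookup[OF J_perp[OF assms]] .
  finally have "cip n x (cd_i n) = 0" .
  then show ?thesis
    using cd_perp_lookup[OF assms] cip_real_left[of n "Re z" x] by (simp add: cd_emb_def cip_commute)
qed

text \<open>Left multiplication by a is skew-adjoint because a^* = -a, which settles the real parts.
  The special cases used later are H(a, a o x) = 0 and H(b, a o b) = 0.\<close>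

lemma H_circ:
  assumes a: "a \<in> cd_perp n" and b: "b \<in> cd_perp n" and x: "x \<in> cd_perp n"
  shows "cd_H n b (cd_circ n a x) = - cd_H n x (cd_circ n a b)"
proof -
  have *: "Re (cd_H n b (cd_circ n a x)) = - Re (cd_H n x (cd_circ n a b))" if x: "x \<in> cd_perp n" for x
  proof -
    have "cip n b (cd_circ n a x) = cip n b (cd_mult n a x)"
      using b by (simp add: cd_circ_def cip_perp_emb)
    also have "\<dots> = - cip n (cd_mult n a b) x"
      using cip_mult_left_adjoint[of a n x b] a b x by (simp add: cip_commute)
    also have "\<dots> = - cip n x (cd_circ n a b)"
      using x by (simp add: cd_circ_def cip_perp_emb cip_commute)
    finally show ?thesis using a b x by (simp add: Re_H)
  qed
  \<comment> \<open>Replacing x by J x multiplies both values by i, so its real parts are the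
    imaginary parts for x up to sign.\<close>
  have "Re (\<i> * cd_H n b (cd_circ n a x)) = - Re (\<i> * cd_H n x (cd_circ n a b))"
    using *[of "cd_J n x"] a b x by (simp add: J_bilinear)
  then show ?thesis using *[OF x] by (simp add: complex_eq_iff)
qed

lemma cip_J_J: "x \<in> cd_carrier n \<Longrightarrow> cip n (cd_J n x) (cd_J n x) = cip n x x"
  by (erule carrier_pair_cases)
     (simp add: cd_J_pair cip_conj_conj del: cd_mult.simps(2) cd_mult_pair cd_i.simps)

subsection \<open>Zero divisors\<close>

text \<open>Test x y = 0 against y and against i y: by adjointness these pairings are |y|^2 <x, 1>
  and |y|^2 <x, i>.\<close>

lemma zero_divisor_left:
  assumes "x \<in> cd_carrier n" "y \<in> cd_carrier n" "cd_mult n x y = 0" "y \<noteq> 0"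
  shows "x \<in> cd_perp n"
proof -
  have y0: "cip n y y \<noteq> 0" using assms cip_eq_0 by blast
  have "cip n x (cd_mult n y (cd_conj n y)) = 0"
    using cip_mult_right_adjoint[of x n y y] assms by simp
  then have re: "Poly_Mapping.lookup x 0 = 0"
    using assms y0 by (simp add: cd_mult_conj_self cip_commute[of n x])
  \<comment> \<open>This instance of associativity survives in every A_n: on pairs the first
    components cancel and the second add up to |y|^2.\<close>
  have "cd_mult n (cd_J n y) (cd_conj n y) = cip n y y *\<^sub>R cd_i n"
  proof -
    obtain m a b where *: "n = Suc m" "a \<in> cd_carrier m" "b \<in> cd_carrier m" "y = cd_pair m a b"
      using assms(2) carrier_pair_cases by blast
    then show ?thesis
      using cd_pair_scaleR[of m "cip m a a + cip m b b" 0 1]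
      by (simp add: cd_J_pair cd_mult_conj_self single_add[symmetric] real_single_scaleR[of _ 1, simplified]
           algebra_simps del: cd_mult.simps(2) cd_conj.simps(2))
  qed
  moreover have "cip n x (cd_mult n (cd_J n y) (cd_conj n y)) = 0"
    using cip_mult_right_adjoint[of x n y "cd_J n y"] assms by simp
  ultimately have "cip n x (cd_i n) = 0" using y0 by simp
  moreover have "cip n x (cd_i n) = Poly_Mapping.lookup x (2 ^ (n - 1))"
  proof -
    obtain m where n: "n = Suc m" using n_pos gr0_implies_Suc by blast
    have "cip n x (cd_i n) = (\<Sum>k<2 ^ n. if k = 2 ^ m then Poly_Mapping.lookup x k else 0)"
      unfolding cip_def n by (rule sum.cong) (auto simp: cd_i_Suc_lookup simp del: cd_i.simps)
    then show ?thesis by (simp add: n)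
  qed
  ultimately show ?thesis
    using re assms(1) by (intro cd_perpI) (simp_all add: cd_prj_def complex_eq_iff)
qed

lemma zero_divisor_right:
  assumes "x \<in> cd_carrier n" "y \<in> cd_carrier n" "cd_mult n x y = 0" "x \<noteq> 0"
  shows "y \<in> cd_perp n"
proof -
  have "cd_conj n x \<noteq> 0"
  proof
    assume "cd_conj n x = 0"
    then have "cd_conj n (cd_conj n x) = 0" by (simp only: cd_conj_zero)
    with assms(1,4) show False by simp
  qed
  moreover have "cd_mult n (cd_conj n y) (cd_conj n x) = 0"
    using cd_conj_mult[OF assms(1,2)] assms(3) by simp
  ultimately have *: "cd_conj n y \<in> cd_perp n"
    using zero_divisor_left[of "cd_conj n y" "cd_conj n x"] assms(1,2) by simp
  have "cd_prj n y = cnj (cd_prj n (cd_conj n y))"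
    using cd_prj_conj[of "cd_conj n y" n] n_pos assms(2) by simp
  with * assms(2) show ?thesis by (intro cd_perpI) simp_all
qed

end

subsection \<open>The splitting of the next algebra\<close>

text \<open>The factor 1/sqrt 2 of \<open>cd_brace\<close> is dropped to keep the annihilator
  equations free of roots. \<open>w\<close> packs the i_n-coefficients of both blocks, so every
  element of \<open>cd_perp (Suc n)\<close> has this form.\<close>

definition cd_P :: "nat \<Rightarrow> complex \<Rightarrow> cd \<Rightarrow> cd \<Rightarrow> cd" where
  "cd_P n w x y = cd_pair n (cd_emb n (\<i> * Im w) + (x + y)) (cd_emb n (\<i> * Re w) + cd_J n (y - x))"

context cd_level
begin

lemma mult_split_pairs:
  assumes "u \<in> cd_perp n" "v \<in> cd_perp n"
  shows "cd_mult n (cd_emb n z + u) (cd_emb n w + v) =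
    cd_emb n (z * w + cd_H n u v) + (cd_sc n z v + cd_sc n (cnj w) u + cd_circ n u v)"
  using assms by (simp add: emb_mult perp_mult_emb emb_mult_emb[unfolded emb_mult[OF cd_emb_carrier]]
      cd_mult_split[of n u v] cd_emb_add)

lemma conj_P_component:
  assumes "u \<in> cd_perp n"
  shows "cd_conj n (cd_emb n (\<i> * complex_of_real r) + u) = - (cd_emb n (\<i> * complex_of_real r) + u)"
proof (rule cd_conj_imaginary)
  have "Re (cd_prj n (cd_emb n (\<i> * complex_of_real r) + u)) = 0"
    using assms by simp
  then show "Poly_Mapping.lookup (cd_emb n (\<i> * complex_of_real r) + u) 0 = 0"
    by (simp add: cd_prj_def)
qed (use assms in simp)

lemma emb_split_eq_0_iff: "u \<in> cd_perp n \<Longrightarrow> cd_emb n z + u = 0 \<longleftrightarrow> z = 0 \<and> u = 0"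
  using split_eq_iff[of u 0 z 0] by simp

lemma J_eq_0_iff: "x \<in> cd_carrier n \<Longrightarrow> cd_J n x = 0 \<longleftrightarrow> x = 0"
  using J_J[of x] by (auto simp del: J_J)

text \<open>The blocks of the product have perpendicular parts X + Y and J (Y - X), where X and Y
  are the left sides of the first two equations. Their complex parts z1 and z2 give the other
  two.\<close>

lemma P_mult_eq_0_iff:
  assumes V: "a \<in> cd_perp n" "b \<in> cd_perp n" "x \<in> cd_perp n" "y \<in> cd_perp n"
  shows "cd_mult (Suc n) (cd_P n w a b) (cd_P n v x y) = 0 \<longleftrightarrow>
    2 *\<^sub>R cd_circ n a x + cd_sc n w y - cd_sc n v b = 0 \<and>
    2 *\<^sub>R cd_circ n b y - cd_sc n (cnj w) x + cd_sc n (cnj v) a = 0 \<and>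
    2 * cnj (cd_H n a x) + 2 * cd_H n b y = w * cnj v \<and>
    cd_H n a y = cd_H n x b"
proof -
  define X Y where "X = 2 *\<^sub>R cd_circ n a x + cd_sc n w y - cd_sc n v b"
    and "Y = 2 *\<^sub>R cd_circ n b y - cd_sc n (cnj w) x + cd_sc n (cnj v) a"
  have XY: "X \<in> cd_perp n" "Y \<in> cd_perp n" using V by (simp_all add: X_def Y_def)
  define p q r s where "p = cd_emb n (\<i> * Im w) + (a + b)" and "q = cd_emb n (\<i> * Re w) + cd_J n (b - a)"
    and "r = cd_emb n (\<i> * Im v) + (x + y)" and "s = cd_emb n (\<i> * Re v) + cd_J n (y - x)"
  have c: "p \<in> cd_carrier n" "q \<in> cd_carrier n" "r \<in> cd_carrier n" "s \<in> cd_carrier n"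
    using V by (simp_all add: p_def q_def r_def s_def)
  \<comment> \<open>With r and s imaginary, (p,q)(r,s) simplifies to (p r + s q, s p - q r).\<close>
  have conj: "cd_conj n r = - r" "cd_conj n s = - s"
    unfolding r_def s_def by (intro conj_P_component; use V in \<open>simp del: cd_mult_diff_right\<close>)+
  define z1 z2 where "z1 = (\<i> * Im w) * (\<i> * Im v) + cd_H n (a + b) (x + y) +
      ((\<i> * Re v) * (\<i> * Re w) + cd_H n (cd_J n (y - x)) (cd_J n (b - a)))"
    and "z2 = (\<i> * Re v) * (\<i> * Im w) + cd_H n (cd_J n (y - x)) (a + b) -
      ((\<i> * Re w) * (\<i> * Im v) + cd_H n (cd_J n (b - a)) (x + y))"
  have J: "cd_J n (b - a) \<in> cd_perp n" "cd_J n (y - x) \<in> cd_perp n"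
    by (intro J_perp cd_perp_diff V)+
  have S: "a + b \<in> cd_perp n" "x + y \<in> cd_perp n" by (intro cd_perp_add V)+
  have C: "cd_circ n x a = - cd_circ n a x" "cd_circ n x b = - cd_circ n b x"
      "cd_circ n y a = - cd_circ n a y" "cd_circ n y b = - cd_circ n b y"
    using V circ_commute by blast+
  have D: "cd_J n (2 * u) = 2 * cd_J n u" for u by (simp only: mult_2 cd_mult_add_right)
  have "cd_mult (Suc n) (cd_P n w a b) (cd_P n v x y) =
     cd_pair n (cd_mult n p r + cd_mult n s q) (cd_mult n s p - cd_mult n q r)"
    unfolding cd_P_def p_def[symmetric] q_def[symmetric] r_def[symmetric] s_def[symmetric]
    using c by (simp add: conj del: cd_mult.simps(2))
  also have "cd_mult n p r + cd_mult n s q = cd_emb n z1 + (X + Y)"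
    unfolding p_def q_def r_def s_def mult_split_pairs[OF S] mult_split_pairs[OF J(2,1)]
      z1_def X_def Y_def cd_emb_add
    using V by (simp add: J_bilinear cd_sc_def C algebra_simps scaleR_2)
  also have "cd_mult n s p - cd_mult n q r = cd_emb n z2 + cd_J n (Y - X)"
    unfolding p_def q_def r_def s_def mult_split_pairs[OF J(2) S(1)] mult_split_pairs[OF J(1) S(2)]
      z2_def X_def Y_def cd_emb_diff scaleR_2
    using V by (simp add: J_bilinear cd_sc_def C algebra_simps D)
  finally have "cd_mult (Suc n) (cd_P n w a b) (cd_P n v x y) = 0 \<longleftrightarrow>
      (z1 = 0 \<and> X + Y = 0) \<and> (z2 = 0 \<and> cd_J n (Y - X) = 0)"
    using XY by (simp add: cd_pair_eq_0_iff emb_split_eq_0_iff del: cd_mult_diff_right)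
  also have "\<dots> \<longleftrightarrow> (X + Y = 0 \<and> Y - X = 0) \<and> (z1 = 0 \<and> z2 = 0)"
    using XY by (auto simp: J_eq_0_iff simp del: cd_mult_diff_right)
  also have "X + Y = 0 \<and> Y - X = 0 \<longleftrightarrow> X = 0 \<and> Y = 0"
  proof
    assume *: "X + Y = 0 \<and> Y - X = 0"
    have "2 *\<^sub>R X = (X + Y) - (Y - X)" unfolding scaleR_2 by simp
    with * have "2 *\<^sub>R X = 0" by (simp only: diff_self)
    with * show "X = 0 \<and> Y = 0" by simp
  qed auto
  \<comment> \<open>The real parts of z1 and z2 are the real and imaginary parts of the third
    equation. Their imaginary parts are twice the imaginary and real parts of H(a,y) -
    H(x,b).\<close>
  also have "z1 = 0 \<and> z2 = 0 \<longleftrightarrow> 2 * cnj (cd_H n a x) + 2 * cd_H n b y = w * cnj v \<and> cd_H n a y = cd_H n x b"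
  proof -
    have "cd_H n y a = cnj (cd_H n a y)" "cd_H n y b = cnj (cd_H n b y)"
      "cd_H n x a = cnj (cd_H n a x)" "cd_H n x b = cnj (cd_H n b x)"
      using V H_commute by blast+
    then show ?thesis
      unfolding z1_def z2_def using V
      by (simp add: J_bilinear complex_eq_iff) (auto simp: algebra_simps)
  qed
  finally show ?thesis by (simp add: X_def Y_def)
qed

end

subsection \<open>Dimensions of subspaces of Cayley-Dickson algebras\<close>

definition cd_basis :: "nat \<Rightarrow> cd set" where
  "cd_basis n = (\<lambda>k. Poly_Mapping.single k 1) ` {..<2 ^ n}"

lemma finite_cd_basis [simp]: "finite (cd_basis n)"
  by (simp add: cd_basis_def)

lemma carrier_span_basis: "cd_carrier n \<subseteq> span (cd_basis n)"
proof
  fix x assume x: "x \<in> cd_carrier n"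
  have "x = (\<Sum>k<2 ^ n. Poly_Mapping.lookup x k *\<^sub>R Poly_Mapping.single k 1)" (is "x = ?s")
  proof (rule poly_mapping_eqI)
    fix j
    have "Poly_Mapping.lookup ?s j =
        (\<Sum>k<(2::nat) ^ n. if k = j then Poly_Mapping.lookup x j else 0)"
      unfolding lookup_sum by (rule sum.cong) (auto simp: lookup_single when_def)
    also have "\<dots> = Poly_Mapping.lookup x j"
      using x by (auto simp: cd_carrier_iff not_less)
    finally show "Poly_Mapping.lookup x j = Poly_Mapping.lookup ?s j" by simp
  qed
  moreover have "?s \<in> span (cd_basis n)"
    by (intro span_sum span_scale span_base) (auto simp: cd_basis_def)
  ultimately show "x \<in> span (cd_basis n)" by simp
qed

lemma rank_nullity_cd:
  fixes f :: "cd \<Rightarrow> 'b::real_vector"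
  assumes "S \<subseteq> cd_carrier n" "subspace S" "linear f"
  shows "dim S = dim {x \<in> S. f x = 0} + dim (f ` S)"
  using rank_nullity[OF finite_cd_basis _ assms(2,3)] assms(1) carrier_span_basis[of n] by blast

lemma dim_image_inj_cd:
  fixes f :: "cd \<Rightarrow> 'b::real_vector"
  assumes "S \<subseteq> cd_carrier n" "subspace S" "linear f" "\<And>x. x \<in> S \<Longrightarrow> f x = 0 \<Longrightarrow> x = 0"
  shows "dim (f ` S) = dim S"
  using dim_image_inj[OF finite_cd_basis _ assms(2,3,4)] assms(1) carrier_span_basis[of n] by blast

lemma dim_mono_cd:
  assumes "T \<subseteq> cd_carrier n" "S \<subseteq> T"
  shows "dim S \<le> dim T"
  using dim_mono_finite[OF finite_cd_basis _ assms(2)] assms(1) carrier_span_basis[of n] by blast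

lemma dim_le_inj_cd:
  fixes f :: "cd \<Rightarrow> cd"
  assumes "S \<subseteq> cd_carrier m" "subspace S" "linear f" "\<And>x. x \<in> S \<Longrightarrow> f x = 0 \<Longrightarrow> x = 0"
    and "\<And>x. x \<in> S \<Longrightarrow> f x \<in> T" "T \<subseteq> cd_carrier n"
  shows "dim S \<le> dim T"
  using dim_image_inj_cd[OF assms(1-4)] dim_mono_cd[OF assms(6), of "f ` S"] assms(5) by force

lemma dim_le_kernel_cd:
  fixes f :: "cd \<Rightarrow> 'b::euclidean_space"
  assumes "S \<subseteq> cd_carrier n" "subspace S" "linear f"
  shows "dim S \<le> dim {x \<in> S. f x = 0} + DIM('b)"
  using rank_nullity_cd[OF assms] dim_subset_UNIV[of "f ` S"] by simp

lemma linear_cd_pair_right: "linear (cd_pair n 0)"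
  using cd_pair_add[of n 0 0] cd_pair_scaleR[of n _ 0] by (intro linearI) simp_all

lemma dim_pairs:
  assumes "A \<subseteq> cd_carrier n" "subspace A" "B \<subseteq> cd_carrier n" "subspace B"
  shows "dim {cd_pair n a b | a b. a \<in> A \<and> b \<in> B} = dim A + dim B"
proof -
  let ?S = "{cd_pair n a b | a b. a \<in> A \<and> b \<in> B}"
  have "subspace ?S"
  proof (rule subspaceI)
    show "0 \<in> ?S"
      using subspace_0[OF assms(2)] subspace_0[OF assms(4)] cd_pair_zero by force
    show "x + y \<in> ?S" if "x \<in> ?S" "y \<in> ?S" for x y
      using that subspace_add[OF assms(2)] subspace_add[OF assms(4)]
      by (auto simp: cd_pair_add[symmetric]) blast
    show "r *\<^sub>R x \<in> ?S" if "x \<in> ?S" for r x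
      using that subspace_scale[OF assms(2)] subspace_scale[OF assms(4)]
      by (auto simp: cd_pair_scaleR[symmetric]) blast
  qed
  moreover have "?S \<subseteq> cd_carrier (Suc n)" by auto
  ultimately have "dim ?S = dim {x \<in> ?S. cd_fst n x = 0} + dim (cd_fst n ` ?S)"
    by (intro rank_nullity_cd linear_cd_fst)
  also have "cd_fst n ` ?S = A"
  proof
    show "cd_fst n ` ?S \<subseteq> A" using assms by auto
    show "A \<subseteq> cd_fst n ` ?S"
    proof
      fix a assume "a \<in> A"
      then have "cd_pair n a 0 \<in> ?S" "a = cd_fst n (cd_pair n a 0)"
        using subspace_0[OF assms(4)] assms(1) by auto
      then show "a \<in> cd_fst n ` ?S" by blast
    qed
  qed
  also have "{x \<in> ?S. cd_fst n x = 0} = cd_pair n 0 ` B"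
    using assms subspace_0[OF assms(2)] by (auto simp: subset_iff image_iff)
  also have "dim (cd_pair n 0 ` B) = dim B"
    using assms by (intro dim_image_inj_cd linear_cd_pair_right) (auto simp: cd_pair_eq_0_iff)
  finally show ?thesis by simp
qed

lemma dim_carrier: "dim (cd_carrier n) = 2 ^ n"
proof (induction n)
  case 0
  have "cd_carrier 0 = span {1}"
    using real_single_scaleR[of _ 1] by (auto simp: span_singleton cd_carrier_0)
  moreover have "independent {1 :: cd}" by simp
  ultimately show ?case using dim_span_eq_card_independent[of "{1::cd}"] by simp
next
  case (Suc n)
  have "cd_carrier (Suc n) = {cd_pair n a b | a b. a \<in> cd_carrier n \<and> b \<in> cd_carrier n}"
    using carrier_Suc_cases[of _ n] cd_pair_carrier by blast
  then show ?case
    using dim_pairs[of "cd_carrier n" n "cd_carrier n"] Suc by (simp add: cd_carrier_subspace)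
qed

lemma cd_Ann_carrier: "cd_Ann n x \<subseteq> cd_carrier n"
  by (auto simp: cd_Ann_def)

lemma subspace_cd_Ann: "subspace (cd_Ann n x)"
  by (rule subspaceI) (auto simp: cd_Ann_def)

lemma cd_Ann_scaleR: "r \<noteq> 0 \<Longrightarrow> cd_Ann n (r *\<^sub>R x) = cd_Ann n x"
  by (auto simp: cd_Ann_def)

lemma dim_cd_Ann_pos:
  assumes "dim (cd_Ann n x) > 0"
  obtains y where "y \<in> cd_carrier n" "cd_mult n x y = 0" "y \<noteq> 0"
proof -
  have "cd_Ann n x \<noteq> {0}" using assms by (metis dim_zero_set less_irrefl)
  moreover have "0 \<in> cd_Ann n x" by (simp add: cd_Ann_def)
  ultimately obtain y where "y \<in> cd_Ann n x" "y \<noteq> 0" by blast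
  with that show thesis by (auto simp: cd_Ann_def)
qed

subsection \<open>The sign automorphism\<close>

text \<open>An involutive automorphism of A_(n+1). It swaps the slots a and b of
  \<open>cd_P\<close>, turning w into - cnj w, so that results for one slot carry over to the
  other.\<close>

definition cd_theta :: "nat \<Rightarrow> cd \<Rightarrow> cd" where
  "cd_theta n x = cd_pair n (cd_fst n x) (- cd_snd n x)"

lemma linear_cd_theta: "linear (cd_theta n)"
  by (rule linearI) (simp_all add: cd_theta_def cd_pair_add[symmetric] cd_pair_scaleR[symmetric])

lemma cd_theta_carrier [simp]: "cd_theta n x \<in> cd_carrier (Suc n)"
  by (simp add: cd_theta_def)

lemma cd_theta_theta [simp]: "x \<in> cd_carrier (Suc n) \<Longrightarrow> cd_theta n (cd_theta n x) = x"
  by (simp add: cd_theta_def cd_pair_fst_snd)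

lemma cd_theta_mult:
  assumes "x \<in> cd_carrier (Suc n)" "y \<in> cd_carrier (Suc n)"
  shows "cd_mult (Suc n) (cd_theta n x) (cd_theta n y) = cd_theta n (cd_mult (Suc n) x y)"
proof -
  obtain a b where x: "a \<in> cd_carrier n" "b \<in> cd_carrier n" "x = cd_pair n a b"
    using assms(1) by (elim carrier_Suc_cases)
  obtain c d where y: "c \<in> cd_carrier n" "d \<in> cd_carrier n" "y = cd_pair n c d"
    using assms(2) by (elim carrier_Suc_cases)
  show ?thesis using x y by (simp add: cd_theta_def minus_diff_commute del: cd_mult.simps(2))
qed

lemma dim_Ann_theta:
  assumes "x \<in> cd_carrier (Suc n)"
  shows "dim (cd_Ann (Suc n) (cd_theta n x)) = dim (cd_Ann (Suc n) x)"
proof -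
  have "dim (cd_Ann (Suc n) x) \<le> dim (cd_Ann (Suc n) (cd_theta n x))"
    if x: "x \<in> cd_carrier (Suc n)" for x
  proof (rule dim_le_inj_cd[OF cd_Ann_carrier subspace_cd_Ann linear_cd_theta _ _ cd_Ann_carrier])
    fix y assume y: "y \<in> cd_Ann (Suc n) x"
    then have yc: "y \<in> cd_carrier (Suc n)" by (auto simp: cd_Ann_def)
    show "y = 0" if "cd_theta n y = 0"
      using arg_cong[OF that, of "cd_theta n"] yc linear_0[OF linear_cd_theta] by simp
    show "cd_theta n y \<in> cd_Ann (Suc n) (cd_theta n x)"
      using y x cd_theta_mult[OF x yc] linear_0[OF linear_cd_theta]
      by (simp add: cd_Ann_def del: cd_mult.simps(2))
  qed
  from this[OF assms] this[OF cd_theta_carrier[of n x]] assms show ?thesis by simp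
qed

lemma cd_theta_P:
  assumes "a \<in> cd_carrier n" "b \<in> cd_carrier n"
  shows "cd_theta n (cd_P n w a b) = cd_P n (- cnj w) b a"
proof -
  have "- (cd_emb n (\<i> * complex_of_real (Re w)) + cd_J n (b - a)) =
    cd_emb n (\<i> * complex_of_real (- Re w)) + cd_J n (a - b)"
    by (simp add: cd_emb_minus)
  then show ?thesis
    using assms by (simp add: cd_theta_def cd_P_def add.commute del: cd_mult_diff_right)
qed

subsection \<open>Annihilators in the next algebra\<close>

definition cd_perp_part :: "nat \<Rightarrow> cd \<Rightarrow> cd" where
  "cd_perp_part n x = x - cd_emb n (cd_prj n x)"

text \<open>Inverts \<open>cd_P\<close>: the blocks have perpendicular parts x + y and J (y - x),
  and J sends the latter to x - y. Defined on all of A_(n+1), the coordinates are linear maps to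
  which rank-nullity applies.\<close>

definition cd_X :: "nat \<Rightarrow> cd \<Rightarrow> cd" where
  "cd_X n z = (1 / 2) *\<^sub>R (cd_perp_part n (cd_fst n z) + cd_J n (cd_perp_part n (cd_snd n z)))"

definition cd_Y :: "nat \<Rightarrow> cd \<Rightarrow> cd" where
  "cd_Y n z = (1 / 2) *\<^sub>R (cd_perp_part n (cd_fst n z) - cd_J n (cd_perp_part n (cd_snd n z)))"

definition cd_W :: "nat \<Rightarrow> cd \<Rightarrow> complex" where
  "cd_W n z = Complex (Im (cd_prj n (cd_snd n z))) (Im (cd_prj n (cd_fst n z)))"

lemma linear_cd_perp_part: "linear (cd_perp_part n)"
  by (rule linearI) (simp_all add: cd_perp_part_def cd_emb_add cd_emb_scaleR algebra_simps)

lemma linear_cd_X: "linear (cd_X n)" and linear_cd_Y: "linear (cd_Y n)"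
  by (auto intro!: linearI simp: cd_X_def cd_Y_def linear_add[OF linear_cd_perp_part]
      linear_scale[OF linear_cd_perp_part] algebra_simps)

lemma linear_cd_W: "linear (cd_W n)"
  by (rule linearI) (simp_all add: cd_W_def complex_eq_iff)

lemma cd_sc_add_left: "cd_sc n (z + w) x = cd_sc n z x + cd_sc n w x"
  and cd_sc_scaleR_left: "cd_sc n (r *\<^sub>R z) x = r *\<^sub>R cd_sc n z x"
  and cd_sc_zero [simp]: "cd_sc n 0 x = 0" "cd_sc n z 0 = 0"
  by (simp_all add: cd_sc_def algebra_simps)

context cd_level
begin

lemma perp_part_emb [simp]: "u \<in> cd_perp n \<Longrightarrow> cd_perp_part n (cd_emb n z + u) = u"
  by (simp add: cd_perp_part_def)

lemma perp_part_perp [simp]: "u \<in> cd_carrier n \<Longrightarrow> cd_perp_part n u \<in> cd_perp n"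
  by (intro cd_perpI) (simp_all add: cd_perp_part_def)

lemma coordinates_P [simp]:
  assumes "x \<in> cd_perp n" "y \<in> cd_perp n"
  shows "cd_X n (cd_P n w x y) = x" "cd_Y n (cd_P n w x y) = y" "cd_W n (cd_P n w x y) = w"
proof -
  have f: "cd_fst n (cd_P n w x y) = cd_emb n (\<i> * Im w) + (x + y)"
    and s: "cd_snd n (cd_P n w x y) = cd_emb n (\<i> * Re w) + cd_J n (y - x)"
    unfolding cd_P_def using assms by simp_all
  have p: "x + y \<in> cd_perp n" "cd_J n (y - x) \<in> cd_perp n"
    using assms by (simp_all del: cd_mult_diff_right)
  have J: "cd_J n (cd_J n (y - x)) = x - y" using assms J_J[of "y - x"] by simp
  have half: "(1 / 2 :: real) *\<^sub>R (u + u) = u" for u :: cd by (simp add: scaleR_2[symmetric])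
  show "cd_X n (cd_P n w x y) = x" "cd_Y n (cd_P n w x y) = y"
    unfolding cd_X_def cd_Y_def f s perp_part_emb[OF p(1)] perp_part_emb[OF p(2)] J
    using half[of x] half[of y] by (simp_all add: algebra_simps)
  show "cd_W n (cd_P n w x y) = w"
    unfolding cd_W_def f s using assms p by (simp add: complex_eq_iff)
qed

lemma XY_perp [simp]: "cd_X n z \<in> cd_perp n" "cd_Y n z \<in> cd_perp n"
  by (simp_all add: cd_X_def cd_Y_def)

lemma P_coordinates:
  assumes "z \<in> cd_perp (Suc n)"
  shows "cd_P n (cd_W n z) (cd_X n z) (cd_Y n z) = z"
proof -
  obtain p q where z: "z = cd_pair n p q" "p \<in> cd_carrier n" "q \<in> cd_carrier n"
     "Poly_Mapping.lookup p 0 = 0" "Poly_Mapping.lookup q 0 = 0"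
    using assms unfolding cd_perp_Suc_iff by blast
  have half: "(1 / 2 :: real) *\<^sub>R u + (1 / 2 :: real) *\<^sub>R u = u" for u :: cd
    by (simp add: scaleR_left_distrib[symmetric])
  have XY: "cd_X n z + cd_Y n z = cd_perp_part n p"
      "cd_Y n z - cd_X n z = - cd_J n (cd_perp_part n q)"
    using z half[of "cd_perp_part n p"] half[of "cd_J n (cd_perp_part n q)"]
    by (simp_all add: cd_X_def cd_Y_def algebra_simps)
  have "cd_J n (cd_Y n z - cd_X n z) = cd_perp_part n q"
    unfolding XY using J_J[of "cd_perp_part n q"] z(3) by simp
  moreover have "\<i> * Im (cd_prj n p) = cd_prj n p" "\<i> * Im (cd_prj n q) = cd_prj n q"
    using z(4,5) by (simp_all add: complex_eq_iff cd_prj_def)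
  ultimately show ?thesis
    unfolding cd_P_def XY using z by (simp add: cd_W_def cd_perp_part_def del: cd_mult_diff_right)
qed

lemma P_perp [simp]:
  assumes "x \<in> cd_perp n" "y \<in> cd_perp n"
  shows "cd_P n w x y \<in> cd_perp (Suc n)"
proof -
  have *: "Poly_Mapping.lookup (cd_emb n (\<i> * complex_of_real r) + u) 0 = 0" if "u \<in> cd_perp n" for r u
  proof -
    have "Re (cd_prj n (cd_emb n (\<i> * complex_of_real r) + u)) = 0"
      using that by simp
    then show ?thesis by (simp add: cd_prj_def)
  qed
  show ?thesis
    unfolding cd_P_def cd_perp_Suc_iff
    by (intro exI conjI; (rule refl | rule *)?; use assms in \<open>simp del: cd_mult_diff_right\<close>)
qed

lemma P_eq_0_iff:
  assumes "x \<in> cd_perp n" "y \<in> cd_perp n"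
  shows "cd_P n w x y = 0 \<longleftrightarrow> w = 0 \<and> x = 0 \<and> y = 0"
  using coordinates_P[OF assms, of w] linear_0[OF linear_cd_X, of n] linear_0[OF linear_cd_Y, of n]
    linear_0[OF linear_cd_W, of n] by (auto simp: cd_P_def)

section \<open>Dimension counts for the annihilator of \<open>cd_P n w a b\<close>\<close>

lemma sc_sc: "x \<in> cd_carrier n \<Longrightarrow> cd_sc n z (cd_sc n w x) = cd_sc n (z * w) x"
  by (simp add: cd_sc_def algebra_simps)

lemma sc_eq_0_iff: "x \<in> cd_carrier n \<Longrightarrow> cd_sc n z x = 0 \<longleftrightarrow> z = 0 \<or> x = 0"
proof
  assume x: "x \<in> cd_carrier n" and *: "cd_sc n z x = 0"
  have "cd_sc n (inverse z * z) x = cd_sc n (inverse z) (cd_sc n z x)"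
    by (rule sc_sc[OF x, symmetric])
  then have "cd_sc n (inverse z * z) x = 0" using * by simp
  then show "z = 0 \<or> x = 0" by (cases "z = 0") (simp_all add: cd_sc_def)
qed auto

text \<open>Two real dimensions are lost to C_n and two to the nonzero complex functional H(b, -).
  This is the origin of every 2^n - 4.\<close>

lemma dim_H_kernel:
  assumes b: "b \<in> cd_perp n" "b \<noteq> 0"
  shows "dim {x \<in> cd_perp n. cd_H n b x = 0} + 4 = 2 ^ n"
proof -
  define f where "f x = (cd_prj n x, cd_H n b x)" for x
  have f: "linear f"
    by (rule linearI) (simp_all add: f_def)
  have bb: "cd_H n b b \<noteq> 0" using b cip_eq_0[of b n] by (simp add: H_self)
  have "(z, w) \<in> f ` cd_carrier n" for z w
  proof (rule image_eqI)
    \<comment> \<open>In the preimage of (z, w) the complex part z does not disturb H, since b z is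
      a multiple of b. The coefficient of b is conjugated because \<open>cd_H\<close> is
      conjugate-linear in its second argument.\<close>
    have "cd_H n b (cd_emb n z) = 0"
      unfolding cd_H_def using b by (simp add: perp_mult_emb)
    then show "(z, w) = f (cd_emb n z + cd_sc n (cnj (w / cd_H n b b)) b)"
      using b bb by (simp add: f_def H_sc_right)
  qed (use b in simp)
  then have "f ` cd_carrier n = UNIV" by auto
  then have "dim (f ` cd_carrier n) = 4" by simp
  moreover have "{x \<in> cd_carrier n. f x = 0} = {x \<in> cd_perp n. cd_H n b x = 0}"
    by (auto simp: f_def zero_prod_def intro: cd_perpI)
  ultimately show ?thesis
    using rank_nullity_cd[of "cd_carrier n" n f] f by (simp add: cd_carrier_subspace dim_carrier)
qed

lemma Ann_P_cases:
  assumes "a \<in> cd_perp n" "b \<in> cd_perp n" "cd_P n w a b \<noteq> 0" "z \<in> cd_Ann (Suc n) (cd_P n w a b)"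
  obtains v x y where "x \<in> cd_perp n" "y \<in> cd_perp n" "z = cd_P n v x y"
    "2 *\<^sub>R cd_circ n a x + cd_sc n w y - cd_sc n v b = 0"
    "2 *\<^sub>R cd_circ n b y - cd_sc n (cnj w) x + cd_sc n (cnj v) a = 0"
    "2 * cnj (cd_H n a x) + 2 * cd_H n b y = w * cnj v"
    "cd_H n a y = cd_H n x b"
proof -
  interpret N: cd_level "Suc n" by standard simp
  have "z \<in> cd_perp (Suc n)"
    using N.zero_divisor_right[of "cd_P n w a b" z] assms unfolding cd_Ann_def by simp
  then have z: "z = cd_P n (cd_W n z) (cd_X n z) (cd_Y n z)" by (simp add: P_coordinates)
  have "cd_mult (Suc n) (cd_P n w a b) (cd_P n (cd_W n z) (cd_X n z) (cd_Y n z)) = 0"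
    using assms(4) z unfolding cd_Ann_def by simp
  then show thesis
    unfolding P_mult_eq_0_iff[OF assms(1,2) XY_perp] using that[OF XY_perp z] by blast
qed

text \<open>The injectivity behind the bound for w nonzero: nothing in the annihilator is lost when
  x is projected away from b. Definiteness of H forces v = 0; then l = 0 and, w being invertible, y
  = 0.\<close>

lemma Ann_P_eq_0:
  assumes V: "a \<in> cd_perp n" "b \<in> cd_perp n" "x \<in> cd_perp n" "y \<in> cd_perp n"
    and w: "w \<noteq> 0" and b: "b \<noteq> 0" and x: "x = cd_sc n l b"
    and E1: "2 *\<^sub>R cd_circ n a x + cd_sc n w y - cd_sc n v b = 0"
    and E3: "2 * cnj (cd_H n a x) + 2 * cd_H n b y = w * cnj v"
    and E4: "cd_H n a y = cd_H n x b"
  shows "v = 0 \<and> x = 0 \<and> y = 0"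
proof -
  define B where "B = cip n b b"
  have B: "B > 0" using V(2) b cip_eq_0[of b n] cip_nonneg[of n b] by (simp add: B_def less_eq_real_def)
  have bb: "cd_H n b b = - B" using V by (simp add: H_self B_def)
  \<comment> \<open>Pairing the first equation with \<open>a\<close> and with \<open>b\<close> eliminates \<open>cd_circ n a x\<close>, which is
    orthogonal to both because \<open>x\<close> is a multiple of \<open>b\<close>.\<close>
  have "cd_H n a (cd_circ n a x) = 0" using H_circ[of a a x] V by simp
  moreover have "cd_H n a (2 *\<^sub>R cd_circ n a x + cd_sc n w y - cd_sc n v b) = 0" unfolding E1 by simp
  ultimately have "cnj w * cd_H n a y = cnj v * cd_H n a b" using V by (simp add: H_sc_right)
  moreover have "cd_H n a y = - l * B" using E4 V x bb by (simp add: H_sc_left)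
  ultimately have 1: "cnj w * l * B = - cnj v * cd_H n a b"
    by (simp add: algebra_simps) (metis minus_minus)
  have "cd_H n b (cd_circ n a x) = 0"
    using H_circ[of a b x] H_circ[of a b b] V x by (simp add: H_sc_left equal_neg_zero)
  moreover have "cd_H n b (2 *\<^sub>R cd_circ n a x + cd_sc n w y - cd_sc n v b) = 0" unfolding E1 by simp
  ultimately have 2: "cnj w * cd_H n b y = - cnj v * B"
    using V bb by (simp add: H_sc_right eq_neg_iff_add_eq_0)
  have 3: "2 * l * cnj (cd_H n a b) + 2 * cd_H n b y = w * cnj v"
    using E3 V x by (simp add: H_sc_right algebra_simps)
  \<comment> \<open>Relation 3 times B * cnj w, with 1 and 2 substituted. The factor of cnj v is at
    least 2 B^2, hence positive.\<close>
  have "cnj v * (2 * (cd_H n a b * cnj (cd_H n a b)) + 2 * (B * B) + B * (w * cnj w)) =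
      B * cnj w * (w * cnj v) - 2 * cnj (cd_H n a b) * (- cnj v * cd_H n a b) - 2 * B * (- cnj v * B)"
    by (simp add: algebra_simps)
  also have "\<dots> = 0"
    unfolding 1[symmetric] 2[symmetric] 3[symmetric] by (simp add: algebra_simps)
  finally have "cnj v * complex_of_real (2 * (cmod (cd_H n a b))\<^sup>2 + 2 * (B * B) + B * (cmod w)\<^sup>2) = 0"
    by (simp only: complex_norm_square of_real_add of_real_mult of_real_numeral)
  moreover have "2 * (cmod (cd_H n a b))\<^sup>2 + 2 * (B * B) + B * (cmod w)\<^sup>2 > 0"
    using B by (intro add_pos_nonneg add_nonneg_pos mult_pos_pos mult_nonneg_nonneg) simp_all
  ultimately have v: "v = 0"
    unfolding mult_eq_0_iff of_real_eq_0_iff by simp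
  with 1 B w have l: "l = 0" by simp
  with x have "x = 0" by simp
  moreover from this E1 v have "y = 0" using w V by (simp add: sc_eq_0_iff)
  ultimately show ?thesis using v by simp
qed

lemma dim_Ann_P_skew_right:
  assumes V: "a \<in> cd_perp n" "b \<in> cd_perp n" and w: "w \<noteq> 0" and b: "b \<noteq> 0"
  shows "dim (cd_Ann (Suc n) (cd_P n w a b)) + 4 \<le> 2 ^ n"
proof -
  define f where "f z = cd_X n z - cd_sc n (cnj (cd_H n b (cd_X n z) / cd_H n b b)) b" for z
  \<comment> \<open>\<open>f z\<close> is the component of \<open>cd_X n z\<close> orthogonal to \<open>b\<close>.\<close>
  have bb: "cd_H n b b \<noteq> 0" using V b cip_eq_0[of b n] by (simp add: H_self)
  have "cnj (r *\<^sub>R h / k) = r *\<^sub>R cnj (h / k)" for r h k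
    by (simp add: scaleR_conv_of_real)
  then have f: "linear f"
    by (intro linearI) (simp_all add: f_def linear_add[OF linear_cd_X] linear_scale[OF linear_cd_X]
        add_divide_distrib cd_sc_add_left cd_sc_scaleR_left[symmetric] scaleR_diff_right del: complex_cnj_divide)
  have P0: "cd_P n w a b \<noteq> 0" using V w by (simp add: P_eq_0_iff)
  have "dim (cd_Ann (Suc n) (cd_P n w a b)) \<le> dim {x \<in> cd_perp n. cd_H n b x = 0}"
  proof (rule dim_le_inj_cd[OF cd_Ann_carrier subspace_cd_Ann f])
    fix z assume z: "z \<in> cd_Ann (Suc n) (cd_P n w a b)" "f z = 0"
    obtain v x y where *: "x \<in> cd_perp n" "y \<in> cd_perp n" "z = cd_P n v x y"
      "2 *\<^sub>R cd_circ n a x + cd_sc n w y - cd_sc n v b = 0"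
      "2 * cnj (cd_H n a x) + 2 * cd_H n b y = w * cnj v"
      "cd_H n a y = cd_H n x b"
      using Ann_P_cases[OF V P0 z(1)] by blast
    have "x = cd_sc n (cnj (cd_H n b x / cd_H n b b)) b"
      using z(2) *(1,2) unfolding f_def *(3) by simp
    from Ann_P_eq_0[OF V *(1,2) w b this *(4-6)] show "z = 0"
      unfolding *(3) using *(1,2) by (simp add: P_eq_0_iff)
  next
    fix z show "f z \<in> {x \<in> cd_perp n. cd_H n b x = 0}"
      using V bb by (simp add: f_def H_sc_right)
  next
    show "{x \<in> cd_perp n. cd_H n b x = 0} \<subseteq> cd_carrier n" by auto
  qed
  with dim_H_kernel[OF V(2) b] show ?thesis by simp
qed

text \<open>\<open>cd_theta\<close> reduces a nonzero to b nonzero. If a = b = 0 the annihilator is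
  trivial, and n >= 2 gives 4 <= 2^n.\<close>

lemma dim_Ann_P_skew:
  assumes V: "a \<in> cd_perp n" "b \<in> cd_perp n" and w: "w \<noteq> 0" and n: "2 \<le> n"
  shows "dim (cd_Ann (Suc n) (cd_P n w a b)) + 4 \<le> 2 ^ n"
proof -
  consider "b \<noteq> 0" | "a \<noteq> 0" | "a = 0" "b = 0" by blast
  then show ?thesis
  proof cases
    case 1
    with dim_Ann_P_skew_right V w show ?thesis by blast
  next
    case 2
    have "dim (cd_Ann (Suc n) (cd_P n w a b)) = dim (cd_Ann (Suc n) (cd_P n (- cnj w) b a))"
      using dim_Ann_theta[of "cd_P n w a b" n] cd_theta_P[of a n b w] V by simp
    with dim_Ann_P_skew_right[OF V(2,1) _ 2, of "- cnj w"] w show ?thesis by simp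
  next
    case 3
    have P0: "cd_P n w 0 0 \<noteq> 0" using w by (simp add: P_eq_0_iff)
    have "z = 0" if z: "z \<in> cd_Ann (Suc n) (cd_P n w 0 0)" for z
      using Ann_P_cases[OF cd_perp_zero cd_perp_zero P0 z]
    proof cases
      case (1 v x y)
      with w have "v = 0" "x = 0" "y = 0" by (simp_all add: sc_eq_0_iff)
      with 1 show ?thesis by (simp add: P_eq_0_iff)
    qed
    then have "cd_Ann (Suc n) (cd_P n w 0 0) \<subseteq> {0}" by blast
    then have "dim (cd_Ann (Suc n) (cd_P n w 0 0)) \<le> dim {0 :: cd}"
      by (rule dim_mono_cd[rotated, of _ _ 0]) simp
    moreover have "(2::nat) ^ 2 \<le> 2 ^ n" using n by (intro power_increasing) auto
    ultimately show ?thesis using 3 by simp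
  qed
qed

text \<open>Imposing H(a,x) = 0 and v = 0 costs at most four real dimensions. The equations then
  decouple into a x = 0 and b y = 0.\<close>

lemma dim_Ann_P_both:
  assumes V: "a \<in> cd_perp n" "b \<in> cd_perp n" and nz: "a \<noteq> 0 \<or> b \<noteq> 0"
  shows "dim (cd_Ann (Suc n) (cd_P n 0 a b)) \<le> dim (cd_Ann n a) + dim (cd_Ann n b) + 4"
proof -
  let ?S = "cd_Ann (Suc n) (cd_P n 0 a b)"
  define f where "f z = (cd_H n a (cd_X n z), cd_W n z)" for z
  define g where "g z = cd_pair n (cd_X n z) (cd_Y n z)" for z
  have f: "linear f"
    by (rule linearI) (simp_all add: f_def linear_add[OF linear_cd_X] linear_scale[OF linear_cd_X]
        linear_add[OF linear_cd_W] linear_scale[OF linear_cd_W])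
  have g: "linear g"
    by (rule linearI) (simp_all add: g_def linear_add[OF linear_cd_X] linear_scale[OF linear_cd_X]
        linear_add[OF linear_cd_Y] linear_scale[OF linear_cd_Y] cd_pair_add cd_pair_scaleR)
  have P0: "cd_P n 0 a b \<noteq> 0" using V nz by (auto simp: P_eq_0_iff)
  have K: "\<exists>x y. z = cd_P n 0 x y \<and> x \<in> cd_perp n \<and> y \<in> cd_perp n \<and> x \<in> cd_Ann n a \<and> y \<in> cd_Ann n b"
    if z: "z \<in> {z \<in> ?S. f z = 0}" for z
  proof -
    have zS: "z \<in> ?S" using z by simp
    show ?thesis
    proof (cases rule: Ann_P_cases[OF V P0 zS])
      case (1 v x y)
      have *: "cd_H n a x = 0" "v = 0"
        using z 1(1,2) unfolding 1(3) by (simp_all add: f_def zero_prod_def)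
      have "cd_circ n a x = 0" "cd_circ n b y = 0" "cd_H n b y = 0"
        using 1(4-6) * by simp_all
      then have "cd_mult n a x = 0" "cd_mult n b y = 0"
        using * by (simp_all add: cd_mult_split)
      then have "x \<in> cd_Ann n a" "y \<in> cd_Ann n b" using 1(1,2) by (simp_all add: cd_Ann_def)
      moreover have "z = cd_P n 0 x y" using 1(3) *(2) by simp
      ultimately show ?thesis using 1(1,2) by blast
    qed
  qed
  have "dim {z \<in> ?S. f z = 0} \<le> dim {cd_pair n x y | x y. x \<in> cd_Ann n a \<and> y \<in> cd_Ann n b}"
  proof (rule dim_le_inj_cd[OF _ _ g])
    show "{z \<in> ?S. f z = 0} \<subseteq> cd_carrier (Suc n)" using cd_Ann_carrier by auto
    show "subspace {z \<in> ?S. f z = 0}"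
      using subspace_cd_Ann[of "Suc n" "cd_P n 0 a b"] f
      by (auto simp: subspace_def linear_add linear_scale linear_0)
    fix z assume z: "z \<in> {z \<in> ?S. f z = 0}"
    obtain x y where *: "z = cd_P n 0 x y" "x \<in> cd_perp n" "y \<in> cd_perp n" "x \<in> cd_Ann n a" "y \<in> cd_Ann n b"
      using K[OF z] by blast
    show "z = 0" if "g z = 0"
      using that *(2,3) unfolding *(1) by (simp add: g_def cd_pair_eq_0_iff P_eq_0_iff)
    show "g z \<in> {cd_pair n x y | x y. x \<in> cd_Ann n a \<and> y \<in> cd_Ann n b}"
      using * by (auto simp: g_def)
  next
    show "{cd_pair n x y | x y. x \<in> cd_Ann n a \<and> y \<in> cd_Ann n b} \<subseteq> cd_carrier (Suc n)" by auto
  qed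
  also have "\<dots> = dim (cd_Ann n a) + dim (cd_Ann n b)"
    by (intro dim_pairs cd_Ann_carrier subspace_cd_Ann)
  finally show ?thesis
    using dim_le_kernel_cd[OF cd_Ann_carrier subspace_cd_Ann f, of "Suc n" "cd_P n 0 a b"] by simp
qed

text \<open>With b = 0 and w = 0 the second equation forces v = 0, and the others say exactly a x =
  0 and H(a,y) = 0, so the annihilator is a product.\<close>

lemma dim_Ann_P_left:
  assumes a: "a \<in> cd_perp n" "a \<noteq> 0"
  shows "dim (cd_Ann (Suc n) (cd_P n 0 a 0)) + 4 = dim (cd_Ann n a) + 2 ^ n"
proof -
  let ?S = "cd_Ann (Suc n) (cd_P n 0 a 0)" and ?K = "{y \<in> cd_perp n. cd_H n a y = 0}"
  define g where "g z = cd_pair n (cd_X n z) (cd_Y n z)" for z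
  have g: "linear g"
    by (rule linearI) (simp_all add: g_def linear_add[OF linear_cd_X] linear_scale[OF linear_cd_X]
        linear_add[OF linear_cd_Y] linear_scale[OF linear_cd_Y] cd_pair_add cd_pair_scaleR)
  have P0: "cd_P n 0 a 0 \<noteq> 0" using a by (auto simp: P_eq_0_iff)
  have S: "\<exists>x y. z = cd_P n 0 x y \<and> x \<in> cd_perp n \<and> x \<in> cd_Ann n a \<and> y \<in> ?K" if z: "z \<in> ?S" for z
  proof (cases rule: Ann_P_cases[OF a(1) cd_perp_zero P0 z])
    case (1 v x y)
    from 1(1,2,4-7) a have "v = 0" "cd_circ n a x = 0" "cd_H n a x = 0" "cd_H n a y = 0"
      by (auto simp: sc_eq_0_iff)
    then have "x \<in> cd_Ann n a" "z = cd_P n 0 x y"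
      using 1(1,3) by (simp_all add: cd_Ann_def cd_mult_split)
    then show ?thesis using 1(1,2) \<open>cd_H n a y = 0\<close> by blast
  qed
  have "dim ?S = dim (g ` ?S)"
  proof (rule dim_image_inj_cd[OF cd_Ann_carrier subspace_cd_Ann g, symmetric])
    fix z assume z: "z \<in> ?S" "g z = 0"
    obtain x y where *: "z = cd_P n 0 x y" "x \<in> cd_perp n" "y \<in> cd_perp n"
      using S[OF z(1)] by blast
    show "z = 0"
      using z(2) *(2,3) unfolding *(1) by (simp add: g_def cd_pair_eq_0_iff P_eq_0_iff)
  qed
  also have "g ` ?S = {cd_pair n x y | x y. x \<in> cd_Ann n a \<and> y \<in> ?K}"
  proof
    show "g ` ?S \<subseteq> {cd_pair n x y | x y. x \<in> cd_Ann n a \<and> y \<in> ?K}"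
    proof
      fix u assume "u \<in> g ` ?S"
      then obtain z where z: "z \<in> ?S" "u = g z" by blast
      obtain x y where *: "z = cd_P n 0 x y" "x \<in> cd_perp n" "x \<in> cd_Ann n a" "y \<in> ?K"
        using S[OF z(1)] by blast
      then have "u = cd_pair n x y" using z(2) by (simp add: g_def)
      with * show "u \<in> {cd_pair n x y | x y. x \<in> cd_Ann n a \<and> y \<in> ?K}" by blast
    qed
    show "{cd_pair n x y | x y. x \<in> cd_Ann n a \<and> y \<in> ?K} \<subseteq> g ` ?S"
    proof
      fix u assume "u \<in> {cd_pair n x y | x y. x \<in> cd_Ann n a \<and> y \<in> ?K}"
      then obtain x y where u: "u = cd_pair n x y" "x \<in> cd_carrier n" "cd_mult n a x = 0"
        "y \<in> cd_perp n" "cd_H n a y = 0" by (auto simp: cd_Ann_def)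
      have x: "x \<in> cd_perp n" using zero_divisor_right[of a x] u a by simp
      have H: "cd_H n a x = 0" using u(3) by (simp add: cd_H_def)
      then have C: "cd_circ n a x = 0" using u(3) by (simp add: cd_circ_def)
      have "cd_mult (Suc n) (cd_P n 0 a 0) (cd_P n 0 x y) = 0"
        using a x u H C by (subst P_mult_eq_0_iff) simp_all
      moreover have "cd_P n 0 x y \<in> cd_carrier (Suc n)" by (simp add: cd_P_def)
      ultimately have "cd_P n 0 x y \<in> ?S" by (simp only: cd_Ann_def mem_Collect_eq simp_thms)
      moreover have "u = g (cd_P n 0 x y)" using x u by (simp add: g_def)
      ultimately show "u \<in> g ` ?S" by blast
    qed
  qed
  also have "dim \<dots> = dim (cd_Ann n a) + dim ?K"
  proof (intro dim_pairs cd_Ann_carrier subspace_cd_Ann)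
    show "subspace ?K" by (rule subspaceI) auto
  qed auto
  finally show ?thesis using dim_H_kernel[OF a] by simp
qed

lemma dim_Ann_P_right:
  assumes "a \<in> cd_perp n" "a \<noteq> 0"
  shows "dim (cd_Ann (Suc n) (cd_P n 0 0 a)) + 4 = dim (cd_Ann n a) + 2 ^ n"
  using dim_Ann_P_left[OF assms] dim_Ann_theta[of "cd_P n 0 a 0" n] cd_theta_P[of a n 0 0] assms
  by simp

section \<open>Norms and the coordinates of {a,0} and {0,a}\<close>

lemma brace_P: "a \<in> cd_carrier n \<Longrightarrow> b \<in> cd_carrier n \<Longrightarrow>
    cd_brace n a b = cd_P n 0 ((1 / sqrt 2) *\<^sub>R a) ((1 / sqrt 2) *\<^sub>R b)"
  by (simp add: cd_brace_def cd_P_def cd_pair_scaleR[symmetric] algebra_simps)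

lemma cip_P:
  assumes "a \<in> cd_carrier n"
  shows "cip (Suc n) (cd_P n 0 a 0) (cd_P n 0 a 0) = 2 * cip n a a"
    "cip (Suc n) (cd_P n 0 0 a) (cd_P n 0 0 a) = 2 * cip n a a"
  using cip_J_J[OF assms] by (simp_all add: cd_P_def)

end

text \<open>For {a,0} and {0,a} the induction step turns the bound for a into exactly the next
  bound. For a, b both nonzero it needs 2 (2^n - 4n + 4) + 4 <= 2^(n+1) - 4n, that is n >=
  3.\<close>

theorem dim_Ann_bound:
  assumes "3 \<le> n" "x \<in> cd_carrier n" "x \<noteq> 0"
  shows "dim (cd_Ann n x) + 4 * n \<le> 2 ^ n + 4"
  using assms
proof (induction n arbitrary: x rule: nat_induct_at_least)
  case base
  then show ?case using cd_Ann_octonion[of x] by simp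
next
  case (Suc n)
  interpret cd_level n by standard (use Suc.hyps in simp)
  interpret N: cd_level "Suc n" by standard simp
  \<comment> \<open>The induction hypothesis at 1 contains this inequality, because a dimension is
    nonnegative. It is what the case of w nonzero needs.\<close>
  have n: "4 * n \<le> 2 ^ n + 4" using Suc.IH[of 1] by simp
  have n3: "(2::nat) ^ 3 \<le> 2 ^ n" using Suc.hyps by (intro power_increasing) auto
  show ?case
  proof (cases "dim (cd_Ann (Suc n) x) = 0")
    case True
    with n n3 show ?thesis by simp
  next
    case False
    then obtain y where "y \<in> cd_carrier (Suc n)" "cd_mult (Suc n) x y = 0" "y \<noteq> 0"
      using dim_cd_Ann_pos by blast
    then have "x \<in> cd_perp (Suc n)"
      using N.zero_divisor_left Suc.prems by blast
    then obtain w a b where x: "x = cd_P n w a b" "a \<in> cd_perp n" "b \<in> cd_perp n"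
      using P_coordinates XY_perp by metis
    consider "w \<noteq> 0" | "w = 0" "a \<noteq> 0" "b = 0" | "w = 0" "a = 0" "b \<noteq> 0" | "w = 0" "a \<noteq> 0" "b \<noteq> 0"
      using Suc.prems(2) x by (auto simp: P_eq_0_iff)
    then show ?thesis
    proof cases
      case 1
      then show ?thesis using dim_Ann_P_skew[OF x(2,3), of w] Suc.hyps n x(1) by simp
    next
      case 2
      then show ?thesis using dim_Ann_P_left[OF x(2)] Suc.IH[of a] x by simp
    next
      case 3
      then show ?thesis using dim_Ann_P_right[OF x(3)] Suc.IH[of b] x by simp
    next
      case 4
      then show ?thesis
        using dim_Ann_P_both[OF x(2,3)] Suc.IH[of a] Suc.IH[of b] x Suc.hyps by simp
    qed
  qed
qed

theorem theorem1p7: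
  fixes n c :: nat
  assumes "n \<ge> 4"
    and "4 dvd c"
    and "int c \<le> 2 ^ n - 4 * int n"
    and "n \<ge> c div 4 + 4"
  shows "cd_T (n + 1) c = {x. \<exists>a \<in> cd_T n c. x = cd_brace n a 0 \<or> x = cd_brace n 0 a}"
proof -
  interpret cd_level n by standard (use assms in simp)
  interpret N: cd_level "Suc n" by standard simp
  have "int c = 4 * int (c div 4)" using assms(2) by (metis dvd_mult_div_cancel of_nat_mult of_nat_numeral)
  \<comment> \<open>For a multiple c of 4 this is the same as c < 4n - 12, the inequality that
    excludes a, b both nonzero.\<close>
  then have c: "int c \<le> 4 * int n - 16" using assms(4) by linarith
  have norm_1: "cd_norm m x = 1 \<longleftrightarrow> cip m x x = 1" if "x \<in> cd_carrier m" for m x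
    using that by (simp add: cd_norm_cip)
  have half: "(1 / sqrt 2) * ((1 / sqrt 2) * r) * 2 = (r :: real)" for r
    by (simp add: field_simps)
  show ?thesis
  proof (intro Set.equalityI subsetI)
    fix x assume "x \<in> {x. \<exists>a\<in>cd_T n c. x = cd_brace n a 0 \<or> x = cd_brace n 0 a}"
    then obtain a where a: "a \<in> cd_T n c" and x: "x = cd_brace n a 0 \<or> x = cd_brace n 0 a"
      by blast
    define a' where "a' = (1 / sqrt 2) *\<^sub>R a"
    have ac: "a \<in> cd_carrier n" "cip n a a = 1"
      and da: "int (dim (cd_Ann n a)) \<ge> 2 ^ n - 4 * int n + 4 - int c"
      using a norm_1 by (auto simp: cd_T_def)
    \<comment> \<open>As c <= 2^n - 4n, the threshold is at least 4, so a is a zero divisor and lies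
      in the complement of C_n.\<close>
    have "dim (cd_Ann n a) > 0" using da assms(3) by linarith
    then have "a \<in> cd_perp n"
      using dim_cd_Ann_pos zero_divisor_left[OF ac(1)] by metis
    then have a': "a' \<in> cd_perp n" by (simp add: a'_def)
    have nz: "a' \<noteq> 0" using ac(2) by (auto simp: a'_def)
    have Ann: "cd_Ann n a' = cd_Ann n a" by (simp add: a'_def cd_Ann_scaleR)
    have cip: "2 * cip n a' a' = 1" using ac(2) half[of 1] by (simp add: a'_def)
    have "x = cd_P n 0 a' 0 \<or> x = cd_P n 0 0 a'"
      using x ac(1) by (auto simp: brace_P a'_def)
    then have xn: "cip (Suc n) x x = 1" "dim (cd_Ann (Suc n) x) + 4 = dim (cd_Ann n a) + 2 ^ n"
      "x \<in> cd_carrier (Suc n)"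
      using cip_P[of a'] cip a' dim_Ann_P_left[OF a' nz] dim_Ann_P_right[OF a' nz] Ann by auto
    \<comment> \<open>The thresholds of T_(n+1)^c and T_n^c also differ by 2^n - 4.\<close>
    have "int (dim (cd_Ann (Suc n) x)) + 4 = int (dim (cd_Ann n a)) + 2 ^ n"
      using arg_cong[OF xn(2), of int] by simp
    then show "x \<in> cd_T (n + 1) c"
      using da xn(1,3) norm_1[of x "Suc n"] by (simp add: cd_T_def)
  next
    fix x assume "x \<in> cd_T (n + 1) c"
    then have xc: "x \<in> cd_carrier (Suc n)" "cip (Suc n) x x = 1"
      and "int (dim (cd_Ann (Suc n) x)) \<ge> 2 ^ Suc n - 4 * int (Suc n) + 4 - int c"
      using norm_1[of x "Suc n"] by (auto simp: cd_T_def)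
    then have dx: "int (dim (cd_Ann (Suc n) x)) \<ge> 2 * 2 ^ n - 4 * int n - int c" by simp
    \<comment> \<open>Again from c <= 2^n - 4n; this lower bound contradicts dim <= 2^n - 4 when w
      is nonzero.\<close>
    have dx': "int (dim (cd_Ann (Suc n) x)) \<ge> 2 ^ n" using dx assms(3) by linarith
    have "dim (cd_Ann (Suc n) x) > 0" using dx' zero_less_power[of "2::int" n] by linarith
    then have "x \<in> cd_perp (Suc n)"
      using dim_cd_Ann_pos N.zero_divisor_left[OF xc(1)] by metis
    then obtain w a b where x: "x = cd_P n w a b" "a \<in> cd_perp n" "b \<in> cd_perp n"
      using P_coordinates XY_perp by metis
    \<comment> \<open>If x is P(0,u,0) or P(0,0,u), then |x|^2 = 2 |u|^2, so the unit vector sought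
      in T_n^c is sqrt 2 times u.\<close>
    have *: "sqrt 2 *\<^sub>R u \<in> cd_T n c"
      if "u \<in> cd_perp n" "2 * cip n u u = 1" "dim (cd_Ann (Suc n) x) + 4 = dim (cd_Ann n u) + 2 ^ n" for u
    proof -
      have "cip n (sqrt 2 *\<^sub>R u) (sqrt 2 *\<^sub>R u) = 1"
        using that(2) by (simp add: mult.assoc[symmetric])
      moreover have "int (dim (cd_Ann n u)) \<ge> 2 ^ n - 4 * int n + 4 - int c"
        using dx arg_cong[OF that(3), of int] by simp
      ultimately show ?thesis
        using that(1) norm_1[of "sqrt 2 *\<^sub>R u" n] by (simp add: cd_T_def cd_Ann_scaleR)
    qed
    have x0: "x \<noteq> 0" using xc(2) by auto
    consider "w \<noteq> 0" | "w = 0" "a \<noteq> 0" "b = 0" | "w = 0" "a = 0" "b \<noteq> 0" | "w = 0" "a \<noteq> 0" "b \<noteq> 0"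
      using x0 x by (auto simp: P_eq_0_iff)
    then show "x \<in> {x. \<exists>a\<in>cd_T n c. x = cd_brace n a 0 \<or> x = cd_brace n 0 a}"
    proof cases
      case 1
      have "int (dim (cd_Ann (Suc n) x) + 4) \<le> int (2 ^ n)"
        using dim_Ann_P_skew[OF x(2,3) 1] assms(1) x(1) by (intro of_nat_mono) simp
      then have False using dx' by simp
      then show ?thesis ..
    next
      case 2
      have "sqrt 2 *\<^sub>R a \<in> cd_T n c"
        using xc(2) 2 x cip_P(1)[of a] dim_Ann_P_left[OF x(2)] by (intro *) simp_all
      moreover have "x = cd_brace n (sqrt 2 *\<^sub>R a) 0"
        using 2 x by (simp add: brace_P)
      ultimately show ?thesis by blast
    next
      case 3
      have "sqrt 2 *\<^sub>R b \<in> cd_T n c"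
        using xc(2) 3 x cip_P(2)[of b] dim_Ann_P_right[OF x(3)] by (intro *) simp_all
      moreover have "x = cd_brace n 0 (sqrt 2 *\<^sub>R b)"
        using 3 x by (simp add: brace_P)
      ultimately show ?thesis by blast
    next
      case 4
      have "dim (cd_Ann (Suc n) x) \<le> dim (cd_Ann n a) + dim (cd_Ann n b) + 4"
        using dim_Ann_P_both[OF x(2,3)] 4 x(1) by simp
      moreover have "dim (cd_Ann n a) + 4 * n \<le> 2 ^ n + 4" "dim (cd_Ann n b) + 4 * n \<le> 2 ^ n + 4"
        using dim_Ann_bound[of n] 4 x assms(1) by simp_all
      \<comment> \<open>Together with \<open>dx\<close> this would give c >= 4n - 12, against
        \<open>c\<close>.\<close>
      ultimately have "dim (cd_Ann (Suc n) x) + 8 * n \<le> 2 * 2 ^ n + 12" by linarith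
      then have "int (dim (cd_Ann (Suc n) x) + 8 * n) \<le> int (2 * 2 ^ n + 12)" by (rule of_nat_mono)
      then have False using dx c by simp
      then show ?thesis ..
    qed
  qed
qed

end
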